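(* There exists a constant $c>0$ such that for all primes $p$, all $n,r\in\mathbb{N}$, all $\varepsilon\in(0,1)$ and all $t\le c\cdot\min\{\varepsilon^2,1/n^2\}\,p^n$, there exists an $\varepsilon$-tester for homomorphism of functions $f:\mathbb{F}_p^n\to\mathbb{F}_p^r$ (as additive groups) that works in the presence of every $t$-online erasure (or corruption) budget-managing adversary and makes $O(1/\varepsilon+\log_p t)$ queries. For erasures, the tester has 1-sided error.
   Context: A homomorphism $h:\mathbb{F}_p^n\to\mathbb{F}_p^r$ satisfies $h(x+y)=h(x)+h(y)$ for all $x,y$. $f$ is $\varepsilon$-far from being a homomorphism if $\Pr_{x}[f(x)\ne h(x)]>\varepsilon$ for every homomorphism $h$ ($x$ uniform in $\mathbb{F}_p^n$). Online manipulation model: the tester accesses $f$ via an oracle for $f'$, initially $f$; the adversary knows all queries made so far and may modify $f'$. A $t$-online budget-managing adversary accumulates $t$ manipulations per answered query and may spend them at any later time; an erasure replaces a value by $\perp$, a corruption by an arbitrary element of $\mathbb{F}_p^r$. An $\varepsilon$-tester must, for every adversarial strategy, accept homomorphisms with probability $\ge2/3$ and reject $\varepsilon$-far functions with probability $\ge 2/3$. 1-sided error: homomorphisms always accepted. $O(\cdot)$ hides an absolute constant. *)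

theory Defs
  imports
    "HOL-Algebra.Product_Groups"
    "HOL-Computational_Algebra.Primes"
    "HOL-Probability.Probability_Mass_Function"
begin

definition Fp_vec :: "nat \<Rightarrow> nat \<Rightarrow> (nat \<Rightarrow> int) monoid" where
  "Fp_vec p n = product_group {..<n} (\<lambda>_. integer_mod_group p)"

definition eps_far_from_hom ::
    "('x, 'm) monoid_scheme \<Rightarrow> ('y, 'k) monoid_scheme \<Rightarrow> real \<Rightarrow> ('x \<Rightarrow> 'y) \<Rightarrow> bool" where
  "eps_far_from_hom G H \<epsilon> f \<longleftrightarrow>
     (\<forall>h\<in>hom G H. measure_pmf.prob (pmf_of_set (carrier G)) {x. f x \<noteq> h x} > \<epsilon>)"

text \<open>The current values of a manipulated function; \<^term>\<open>None\<close> is an erased point.\<close>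

type_synonym ('x, 'y) oracle_state = "'x \<Rightarrow> 'y option"

text \<open>
  A pure strategy of the adversary: it maps the list of queries answered so far (oldest first)
  to the values from which the next query is answered.  The strategy may depend on the input function and
  on the tester, and since the answers are determined by the strategy and the queries, the list
  of queries is all that the adversary learns.
\<close>

type_synonym ('x, 'y) strategy = "'x list \<Rightarrow> ('x, 'y) oracle_state"

text \<open>
  The values start as those of \<open>f\<close>.  Each round of manipulations, made after an answer and before the next
  query, may give points new values from \<open>V\<close>.  Every change of a point costs one unit; after
  each answer the total spent so far is at most \<open>t\<close> times the number of answered queries, so that
  unspent manipulations are kept for later.
\<close>

definition budget_managing ::
    "'x set \<Rightarrow> 'y option set \<Rightarrow> real \<Rightarrow> ('x \<Rightarrow> 'y) \<Rightarrow> ('x, 'y) strategy \<Rightarrow> bool" where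
  "budget_managing X V t f A \<longleftrightarrow>
     (\<forall>z\<in>X. A [] z = Some (f z)) \<and>
     (\<forall>qs\<in>lists X. \<forall>x\<in>X. \<forall>z\<in>X. A (qs @ [x]) z \<noteq> A qs z \<longrightarrow> A (qs @ [x]) z \<in> V) \<and>
     (\<forall>qs\<in>lists X.
        real (\<Sum>i<length qs. card {z\<in>X. A (take (Suc i) qs) z \<noteq> A (take i qs) z})
          \<le> t * real (length qs))"

text \<open>Adversaries may randomize; they are distributions on pure strategies.\<close>

definition erasure_adversary ::
    "('x, 'm) monoid_scheme \<Rightarrow> real \<Rightarrow> ('x \<Rightarrow> 'y) \<Rightarrow> ('x, 'y) strategy pmf \<Rightarrow> bool" where
  "erasure_adversary G t f \<A> \<longleftrightarrow>
     (\<forall>A\<in>set_pmf \<A>. budget_managing (carrier G) {None} t f A)"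

definition corruption_adversary ::
    "('x, 'm) monoid_scheme \<Rightarrow> ('y, 'k) monoid_scheme \<Rightarrow> real \<Rightarrow> ('x \<Rightarrow> 'y) \<Rightarrow>
     ('x, 'y) strategy pmf \<Rightarrow> bool" where
  "corruption_adversary G H t f \<A> \<longleftrightarrow>
     (\<forall>A\<in>set_pmf \<A>. budget_managing (carrier G) (Some ` carrier H) t f A)"

text \<open>
  A deterministic adaptive query algorithm is a decision tree, whose leaves hold the verdict
  (\<^term>\<open>True\<close> means accept).  A randomized algorithm is a distribution on decision trees,
  i.e. the coins are tossed in advance and remain hidden from the adversary.
\<close>

datatype ('x, 'y) query_tree =
    Verdict bool
  | Query 'x "'y option \<Rightarrow> ('x, 'y) query_tree"

text \<open>The list argument of the next two functions holds the queries answered so far.\<close>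

primrec accepts :: "('x, 'y) query_tree \<Rightarrow> ('x, 'y) strategy \<Rightarrow> 'x list \<Rightarrow> bool" where
  "accepts (Verdict b) A qs = b"
| "accepts (Query x next_step) A qs = accepts (next_step (A qs x)) A (qs @ [x])"

primrec query_count :: "('x, 'y) query_tree \<Rightarrow> ('x, 'y) strategy \<Rightarrow> 'x list \<Rightarrow> nat" where
  "query_count (Verdict b) A qs = 0"
| "query_count (Query x next_step) A qs = Suc (query_count (next_step (A qs x)) A (qs @ [x]))"

primrec query_points :: "('x, 'y) query_tree \<Rightarrow> 'x set" where
  "query_points (Verdict b) = {}"
| "query_points (Query x next_step) = insert x (\<Union>a. query_points (next_step a))"

definition prob_accept :: "('x, 'y) query_tree pmf \<Rightarrow> ('x, 'y) strategy pmf \<Rightarrow> real" where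
  "prob_accept T \<A> = measure_pmf.prob (pair_pmf T \<A>) {(d, A). accepts d A []}"

definition prob_reject :: "('x, 'y) query_tree pmf \<Rightarrow> ('x, 'y) strategy pmf \<Rightarrow> real" where
  "prob_reject T \<A> = measure_pmf.prob (pair_pmf T \<A>) {(d, A). \<not> accepts d A []}"

text \<open>
  The parameter \<open>adv\<close> is the class of adversaries that are admissible for a given input function.
\<close>

definition hom_tester ::
    "('x, 'm) monoid_scheme \<Rightarrow> ('y, 'k) monoid_scheme \<Rightarrow> real \<Rightarrow>
     (('x \<Rightarrow> 'y) \<Rightarrow> ('x, 'y) strategy pmf \<Rightarrow> bool) \<Rightarrow> ('x, 'y) query_tree pmf \<Rightarrow> bool" where
  "hom_tester G H \<epsilon> adv T \<longleftrightarrow>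
     (\<forall>d\<in>set_pmf T. query_points d \<subseteq> carrier G) \<and>
     (\<forall>f \<in> carrier G \<rightarrow> carrier H. \<forall>\<A>. adv f \<A> \<longrightarrow>
        (f \<in> hom G H \<longrightarrow> prob_accept T \<A> \<ge> 2/3) \<and>
        (eps_far_from_hom G H \<epsilon> f \<longrightarrow> prob_reject T \<A> \<ge> 2/3))"

definition one_sided ::
    "('x, 'm) monoid_scheme \<Rightarrow> ('y, 'k) monoid_scheme \<Rightarrow>
     (('x \<Rightarrow> 'y) \<Rightarrow> ('x, 'y) strategy pmf \<Rightarrow> bool) \<Rightarrow> ('x, 'y) query_tree pmf \<Rightarrow> bool" where
  "one_sided G H adv T \<longleftrightarrow>
     (\<forall>f\<in>hom G H. \<forall>\<A>. adv f \<A> \<longrightarrow> prob_accept T \<A> = 1)"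

text \<open>The bound is on the worst case: all coins of the algorithm and all possible answers.\<close>

definition makes_at_most_queries :: "('x, 'y) query_tree pmf \<Rightarrow> real \<Rightarrow> bool" where
  "makes_at_most_queries T q \<longleftrightarrow> (\<forall>d\<in>set_pmf T. \<forall>A. real (query_count d A []) \<le> q)"

end

theory Submission
  imports Defs "HOL-Library.NList"
begin

text \<open>
  The tester is non-adaptive.  It queries a reserve \<open>u\<^sub>0, \<dots>, u\<^sub>k\<close> and points \<open>y\<^sub>1, \<dots>, y\<^sub>m\<close>, all
  uniform, and then the points \<open>L(c\<^sub>j)\<close> and \<open>y\<^sub>j + L(d\<^sub>j)\<close>, where \<open>L(a) = u\<^sub>0 + \<Sum> a\<^sub>i u\<^sub>i\<close> and the
  coefficient vectors \<open>c\<^sub>j\<close>, \<open>d\<^sub>j\<close> are uniform and not known to the adversary before the query.  It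
  accepts if some homomorphism agrees with all answers that are not erased.

  A query \<open>L(a)\<close> takes each value with probability at most \<open>|ker| / p^k\<close>, where \<open>ker\<close> is the kernel
  of the linear part of \<open>L\<close>; on average this is at most \<open>1 / p^k + 1 / p^n\<close>.  So with \<open>q\<close> queries a
  manipulated point is seen with probability at most \<open>t q^2 (1 / p^n + 1 / p^k)\<close>, which is small for
  some \<open>k = 2 log\<^sub>p t + O(1 / \<epsilon>)\<close>.

  If \<open>f\<close> is \<open>\<epsilon>\<close>-far, the Blum--Luby--Rubinfeld test \<open>f(x) + f(y) = f(x + y)\<close> fails with probability
  \<open>\<delta> \<ge> \<epsilon> / 6\<close>.  The points \<open>L(a)\<close> are pairwise independent, so by Chebyshev's inequality it still
  fails with probability \<open>\<delta> / 2\<close> for most reserves when \<open>x\<close> is restricted to the points \<open>L(a)\<close>.  The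
  answers on the reserve force the value of a homomorphism at \<open>L(a)\<close>, hence one of the two kinds of
  late queries exposes a contradiction with probability at least \<open>\<epsilon> / 24\<close> each time.
\<close>

section \<open>Averages\<close>

text \<open>Expectation under a uniform choice, kept as a finite sum: independent coins become
  nested averages and Fubini becomes \<open>avg_swap\<close>. An empty or infinite \<open>S\<close>
  gives 0, so the exchange laws hold without side conditions.\<close>

definition avg :: "'a set \<Rightarrow> ('a \<Rightarrow> real) \<Rightarrow> real" where
  "avg S F = (\<Sum>x\<in>S. F x) / real (card S)"

lemma avg_mono: "(\<And>x. x \<in> S \<Longrightarrow> F x \<le> F' x) \<Longrightarrow> avg S F \<le> avg S F'"
  by (simp add: avg_def divide_right_mono sum_mono)

lemma avg_cong: "S = S' \<Longrightarrow> (\<And>x. x \<in> S' \<Longrightarrow> F x = F' x) \<Longrightarrow> avg S F = avg S' F'"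
  by (simp add: avg_def)

lemma avg_const: "finite S \<Longrightarrow> S \<noteq> {} \<Longrightarrow> avg S (\<lambda>_. c) = c"
  by (simp add: avg_def)

lemma avg_nonneg: "(\<And>x. x \<in> S \<Longrightarrow> 0 \<le> F x) \<Longrightarrow> 0 \<le> avg S F"
  by (simp add: avg_def sum_nonneg)

lemma avg_le_const:
  assumes "finite S" "S \<noteq> {}" "\<And>x. x \<in> S \<Longrightarrow> F x \<le> c"
  shows "avg S F \<le> c"
  using avg_mono[of S F "\<lambda>_. c"] avg_const[of S c] assms by simp

lemma avg_add: "avg S (\<lambda>x. F x + F' x) = avg S F + avg S F'"
  by (simp add: avg_def sum.distrib add_divide_distrib)

lemma avg_diff: "avg S (\<lambda>x. F x - F' x) = avg S F - avg S F'"
  by (simp add: avg_def sum_subtractf diff_divide_distrib)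

lemma avg_cmult: "avg S (\<lambda>x. c * F x) = c * avg S F"
  by (simp add: avg_def sum_distrib_left)

lemma avg_multc: "avg S (\<lambda>x. F x * c) = avg S F * c"
  by (simp add: avg_def sum_distrib_right)

lemma avg_swap: "avg S (\<lambda>x. avg S' (F x)) = avg S' (\<lambda>y. avg S (\<lambda>x. F x y))"
  unfolding avg_def sum_divide_distrib[symmetric]
  by (subst sum.swap) (simp add: mult.commute)

lemma avg_Times: "avg (S \<times> S') F = avg S (\<lambda>x. avg S' (\<lambda>y. F (x, y)))"
  by (simp add: avg_def sum_divide_distrib[symmetric] sum.cartesian_product card_cartesian_product
      mult.commute)

lemma avg_reindex: "bij_betw h S S' \<Longrightarrow> avg S (\<lambda>x. F (h x)) = avg S' F"
  by (simp add: avg_def sum.reindex_bij_betw bij_betw_same_card)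

lemma avg_le_exists:
  assumes "finite S" "S \<noteq> {}" "avg S F \<le> c"
  shows "\<exists>x\<in>S. F x \<le> c"
proof (rule ccontr)
  assume "\<not> ?thesis"
  then have "(\<Sum>x\<in>S. c) < (\<Sum>x\<in>S. F x)"
    using assms by (intro sum_strict_mono) auto
  then show False
    using assms by (simp add: avg_def field_simps card_gt_0_iff)
qed

lemma avg_of_bool_not:
  assumes "finite S" "S \<noteq> {}"
  shows "avg S (\<lambda>x. of_bool (\<not> P x)) = 1 - avg S (\<lambda>x. of_bool (P x))"
proof -
  have "avg S (\<lambda>x. of_bool (\<not> P x)) = avg S (\<lambda>x. 1 - of_bool (P x))"
    by (intro avg_cong) auto
  then show ?thesis
    using assms by (simp add: avg_diff avg_const)
qed

lemma avg_of_bool_le_1: "finite S \<Longrightarrow> S \<noteq> {} \<Longrightarrow> avg S (\<lambda>x. of_bool (P x)) \<le> 1"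
  by (intro avg_le_const) auto

lemma avg_of_bool_card: "finite S \<Longrightarrow> avg S (\<lambda>x. of_bool (P x)) = real (card {x\<in>S. P x}) / real (card S)"
  by (simp add: avg_def of_bool_def sum.inter_filter[symmetric])

lemma prob_pmf_of_set_eq_avg:
  assumes "finite S" "S \<noteq> {}"
  shows "measure_pmf.prob (pmf_of_set S) {x. P x} = avg S (\<lambda>x. of_bool (P x))"
  using assms by (simp add: measure_pmf_of_set avg_of_bool_card Collect_conj_eq)

section \<open>Lists of independent uniform samples\<close>

lemma finite_nlists: "finite S \<Longrightarrow> finite (nlists n S)"
  unfolding nlists_def using finite_lists_length_eq[of S n] by (simp only: conj_commute)

lemma card_nlists: "finite S \<Longrightarrow> card (nlists n S) = card S ^ n"
  unfolding nlists_def using card_lists_length_eq[of S n] by (simp only: conj_commute)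

lemma nlists_nonempty: "S \<noteq> {} \<Longrightarrow> nlists n S \<noteq> {}"
  using nlists_not_empty by blast

lemma avg_singleton [simp]: "avg {x} F = F x"
  by (simp add: avg_def)

lemma avg_nlists_Suc: "avg (nlists (Suc n) S) F = avg S (\<lambda>x. avg (nlists n S) (\<lambda>xs. F (x # xs)))"
proof -
  have "bij_betw (\<lambda>(x, xs). x # xs) (S \<times> nlists n S) (nlists (Suc n) S)"
    by (auto simp: bij_betw_def inj_on_def nlists_Suc image_iff)
  from avg_reindex[OF this, of F] show ?thesis
    by (simp add: avg_Times case_prod_unfold)
qed

lemma avg_nlists_all:
  "avg (nlists n S) (\<lambda>xs. of_bool (\<forall>x\<in>set xs. P x)) = avg S (\<lambda>x. of_bool (P x)) ^ n"
  by (induction n) (simp_all add: avg_nlists_Suc of_bool_conj avg_cmult avg_multc)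

text \<open>Two independent lists form one list of independent pairs. They are kept apart here
  because the tester reveals the first list long before the second.\<close>

lemma avg_nlists_list_all2:
  "avg (nlists n S) (\<lambda>xs. avg (nlists n S') (\<lambda>ys. of_bool (list_all2 P xs ys))) =
   avg S (\<lambda>x. avg S' (\<lambda>y. of_bool (P x y))) ^ n"
proof (induction n)
  case 0
  show ?case by simp
next
  case (Suc n)
  have "avg (nlists (Suc n) S) (\<lambda>xs. avg (nlists (Suc n) S') (\<lambda>ys. of_bool (list_all2 P xs ys)))
    = avg S (\<lambda>x. avg S' (\<lambda>y. avg (nlists n S) (\<lambda>xs. avg (nlists n S')
        (\<lambda>ys. of_bool (P x y) * of_bool (list_all2 P xs ys)))))"
    by (simp add: avg_nlists_Suc of_bool_conj avg_swap[of "nlists n S" S'])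
  also have "\<dots> = avg S (\<lambda>x. avg S' (\<lambda>y. of_bool (P x y))) ^ Suc n"
    by (simp add: avg_cmult avg_multc Suc.IH)
  finally show ?case .
qed

text \<open>\<open>M qs\<close> stands for the points spoiled once \<open>qs\<close> has been
  answered. Each query is tested against the set fixed by its predecessors, which is what an online
  adversary can arrange.\<close>

fun hits :: "('a list \<Rightarrow> 'a set) \<Rightarrow> 'a list \<Rightarrow> 'a list \<Rightarrow> bool" where
  "hits M qs [] = False"
| "hits M qs (x # xs) = (x \<in> M qs \<or> hits M (qs @ [x]) xs)"

lemma hits_append: "hits M qs (xs @ ys) \<longleftrightarrow> hits M qs xs \<or> hits M (qs @ xs) ys"
  by (induction xs arbitrary: qs) auto

lemma avg_mem_le:
  assumes "finite B" "\<And>z. avg S (\<lambda>c. of_bool (w c = z)) \<le> \<kappa>"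
  shows "avg S (\<lambda>c. of_bool (w c \<in> B)) \<le> real (card B) * \<kappa>"
proof -
  have "of_bool (w c \<in> B) = (\<Sum>z\<in>B. of_bool (w c = z) :: real)" for c
    using assms(1) by (simp add: of_bool_def)
  then have "avg S (\<lambda>c. of_bool (w c \<in> B)) = (\<Sum>z\<in>B. avg S (\<lambda>c. of_bool (w c = z)))"
    unfolding avg_def sum_divide_distrib[symmetric] by (subst sum.swap) simp
  also have "\<dots> \<le> (\<Sum>z\<in>B. \<kappa>)"
    by (intro sum_mono assms)
  finally show ?thesis by simp
qed

text \<open>Union bound along the query sequence: the spoiled set is fixed before the coin
  \<open>c\<close> of the next query is drawn, so that query lands in it with probability at most
  \<open>\<tau> * \<kappa>\<close>. The parameters \<open>ys\<close> may be known beforehand; only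
  the coins must be fresh.\<close>

lemma avg_hits_le:
  assumes S: "finite S" "S \<noteq> {}"
    and M: "\<And>qs. qs \<in> lists X \<Longrightarrow> length qs \<le> q \<Longrightarrow> finite (M qs) \<and> real (card (M qs)) \<le> \<tau>"
    and w: "\<And>y c. y \<in> set ys \<Longrightarrow> c \<in> S \<Longrightarrow> w y c \<in> X"
    and \<kappa>: "\<And>y z. y \<in> set ys \<Longrightarrow> avg S (\<lambda>c. of_bool (w y c = z)) \<le> \<kappa>" "0 \<le> \<kappa>"
    and qs: "qs \<in> lists X" "length qs + length ys \<le> q"
    and n: "length ys = n"
  shows "avg (nlists n S) (\<lambda>cs. of_bool (hits M qs (map2 w ys cs))) \<le> real n * (\<tau> * \<kappa>)"
  using w \<kappa>(1) qs n
proof (induction n arbitrary: qs ys)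
  case 0
  then show ?case by simp
next
  case (Suc n)
  then obtain y ys' where ys: "ys = y # ys'" "length ys' = n"
    by (cases ys) auto
  let ?F = "\<lambda>c cs. of_bool (w y c \<in> M qs) + of_bool (hits M (qs @ [w y c]) (map2 w ys' cs)) :: real"
  have "avg (nlists (Suc n) S) (\<lambda>cs. of_bool (hits M qs (map2 w ys cs)))
    \<le> avg S (\<lambda>c. avg (nlists n S) (?F c))"
    by (auto simp: avg_nlists_Suc ys intro!: avg_mono)
  also have "\<dots> = avg S (\<lambda>c. of_bool (w y c \<in> M qs)) +
      avg S (\<lambda>c. avg (nlists n S) (\<lambda>cs. of_bool (hits M (qs @ [w y c]) (map2 w ys' cs))))"
    using S by (simp add: avg_add avg_const finite_nlists nlists_nonempty)
  also have "\<dots> \<le> \<tau> * \<kappa> + real n * (\<tau> * \<kappa>)"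
  proof (intro add_mono)
    have "avg S (\<lambda>c. of_bool (w y c \<in> M qs)) \<le> real (card (M qs)) * \<kappa>"
      using Suc.prems M[of qs] ys by (intro avg_mem_le) auto
    also have "\<dots> \<le> \<tau> * \<kappa>"
      using Suc.prems M[of qs] \<kappa>(2) by (intro mult_right_mono) auto
    finally show "avg S (\<lambda>c. of_bool (w y c \<in> M qs)) \<le> \<tau> * \<kappa>" .
    have "avg (nlists n S) (\<lambda>cs. of_bool (hits M (qs @ [w y c]) (map2 w ys' cs)))
        \<le> real n * (\<tau> * \<kappa>)" if "c \<in> S" for c
    \<comment> \<open>The history grows by the query just made; \<open>length qs + length ys\<close>
      stays the same, so the bound on \<open>M\<close> remains available.\<close>
    proof (rule Suc.IH)
      show "avg S (\<lambda>c. of_bool (w y' c = z)) \<le> \<kappa>" if "y' \<in> set ys'" for y' z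
        using that Suc.prems(2) ys by simp
    qed (use that Suc.prems ys in auto)
    then show "avg S (\<lambda>c. avg (nlists n S) (\<lambda>cs. of_bool (hits M (qs @ [w y c]) (map2 w ys' cs))))
        \<le> real n * (\<tau> * \<kappa>)"
      by (rule avg_le_const[OF S])
  qed
  finally show ?case by (simp add: distrib_right)
qed

section \<open>Linear combinations of random group elements\<close>

text \<open>Linear combination in multiplicative notation, with integer powers as scalars. The
  longer list is cut to the length of the shorter one.\<close>

fun lincomb :: "('a, 'b) monoid_scheme \<Rightarrow> 'a list \<Rightarrow> int list \<Rightarrow> 'a" where
  "lincomb G (u # us) (c # cs) = u [^]\<^bsub>G\<^esub> c \<otimes>\<^bsub>G\<^esub> lincomb G us cs"
| "lincomb G us cs = \<one>\<^bsub>G\<^esub>"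

lemma (in group) lincomb_closed [intro, simp]: "set us \<subseteq> carrier G \<Longrightarrow> lincomb G us cs \<in> carrier G"
proof (induction us arbitrary: cs)
  case (Cons u us)
  then show ?case by (cases cs) auto
qed simp

lemma (in group) bij_betw_mult_right: "a \<in> carrier G \<Longrightarrow> bij_betw (\<lambda>x. x \<otimes> a) (carrier G) (carrier G)"
  by (rule bij_betw_byWitness[of _ "\<lambda>x. x \<otimes> inv a"]) (auto simp: m_assoc)

lemma (in group) bij_betw_mult_left: "a \<in> carrier G \<Longrightarrow> bij_betw (\<lambda>x. a \<otimes> x) (carrier G) (carrier G)"
  by (rule bij_betw_byWitness[of _ "\<lambda>x. inv a \<otimes> x"]) (auto simp: m_assoc[symmetric])

lemma lincomb_hom:
  assumes "h \<in> hom G H" "group G" "group H" "set us \<subseteq> carrier G"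
  shows "h (lincomb G us cs) = lincomb H (map h us) cs"
proof -
  interpret group_hom G H h
    using assms by (simp add: group_hom_def group_hom_axioms_def)
  show ?thesis
    using assms(4)
  proof (induction us arbitrary: cs)
    case (Cons u us)
    then show ?case by (cases cs) (auto simp: hom_int_pow)
  qed simp
qed

text \<open>Elementary abelian p-groups, that is, finite vector spaces over the field with p
  elements, written multiplicatively.\<close>

locale exponent_p_group = comm_group G for G (structure) +
  fixes p :: nat
  assumes fin: "finite (carrier G)" and prime_p: "prime p"
    and exponent: "x \<in> carrier G \<Longrightarrow> x [^] p = \<one>"
begin

abbreviation "N \<equiv> real (card (carrier G))"

lemma carrier_ne: "carrier G \<noteq> {}"
  by blast

lemma N_pos: "0 < N"
  using fin carrier_ne by (simp add: card_gt_0_iff)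

lemmas avg_carrier_const = avg_const[OF fin carrier_ne]

lemma int_pow_dvd: "x \<in> carrier G \<Longrightarrow> int p dvd c \<Longrightarrow> x [^] c = \<one>"
  by (auto elim!: dvdE simp: int_pow_pow[symmetric] int_pow_int exponent)

lemma int_pow_mod: "x \<in> carrier G \<Longrightarrow> x [^] (c mod int p) = x [^] c"
proof -
  assume x: "x \<in> carrier G"
  have "x [^] c = x [^] (int p * (c div int p) + c mod int p)"
    by simp
  also have "\<dots> = x [^] (c mod int p)"
    using x by (simp only: int_pow_mult) (simp add: int_pow_dvd)
  finally show ?thesis by simp
qed

text \<open>Scalar multiplication by a unit modulo \<open>p\<close>; the Bezout coefficient of
  \<open>c\<close> provides the inverse map.\<close>

lemma bij_betw_int_pow:
  assumes "\<not> int p dvd c"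
  shows "bij_betw (\<lambda>x. x [^] c) (carrier G) (carrier G)"
proof -
  have "gcd c (int p) = 1"
    using assms prime_p prime_imp_coprime[of "int p" c] by (simp add: coprime_commute)
  then obtain d v where "d * c + v * int p = 1"
    by (metis bezout_int)
  then have d: "(c * d) mod int p = 1 mod int p"
    by (metis mod_mult_self1 mult.commute)
  have "x [^] (c * d) = x" if "x \<in> carrier G" for x
    using that d int_pow_mod[of x "c * d"] int_pow_mod[of x 1] by simp
  then show ?thesis
    by (intro bij_betw_byWitness[of _ "\<lambda>x. x [^] d"]) (auto simp: int_pow_pow mult.commute)
qed

text \<open>One coefficient that is invertible modulo \<open>p\<close> already makes the combination
  uniform. For fixed other samples, its term runs uniformly through the group, and the remaining
  factor only translates it.\<close>

lemma avg_lincomb: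
  assumes "\<exists>c\<in>set cs. \<not> int p dvd c" "length cs = n"
  shows "avg (nlists n (carrier G)) (\<lambda>us. F (lincomb G us cs)) = avg (carrier G) F"
  using assms
proof (induction cs arbitrary: n)
  case Nil
  then show ?case by simp
next
  case (Cons c cs)
  then obtain n' where n: "n = Suc n'" "length cs = n'" by auto
  have us: "lincomb G us cs \<in> carrier G" if "us \<in> nlists n' (carrier G)" for us
    using that by simp
  show ?case
  proof (cases "int p dvd c")
    case True
    have "avg (nlists n (carrier G)) (\<lambda>us. F (lincomb G us (c # cs))) =
      avg (carrier G) (\<lambda>u. avg (nlists n' (carrier G)) (\<lambda>us. F (lincomb G us cs)))"
      using True us by (auto simp: n avg_nlists_Suc int_pow_dvd intro!: avg_cong)
    also have "\<dots> = avg (carrier G) F"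
      using Cons n True by (simp add: avg_carrier_const)
    finally show ?thesis .
  next
    case False
    have "avg (nlists n (carrier G)) (\<lambda>us. F (lincomb G us (c # cs))) =
      avg (nlists n' (carrier G)) (\<lambda>us. avg (carrier G) (\<lambda>u. F (u [^] c \<otimes> lincomb G us cs)))"
      by (simp add: n avg_nlists_Suc avg_swap[of "carrier G"])
    also have "\<dots> = avg (nlists n' (carrier G)) (\<lambda>us. avg (carrier G) F)"
    proof (rule avg_cong)
      fix us assume "us \<in> nlists n' (carrier G)"
      then show "avg (carrier G) (\<lambda>u. F (u [^] c \<otimes> lincomb G us cs)) = avg (carrier G) F"
        by (subst avg_reindex[OF bij_betw_int_pow[OF False], of "\<lambda>u. F (u \<otimes> lincomb G us cs)"])
           (rule avg_reindex[OF bij_betw_mult_right[OF us]])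
    qed simp
    also have "\<dots> = avg (carrier G) F"
      using fin carrier_ne by (intro avg_const finite_nlists nlists_nonempty)
    finally show ?thesis .
  qed
qed

lemma lincomb_diff:
  assumes "set us \<subseteq> carrier G" "length cs = length ds"
  shows "lincomb G us cs \<otimes> lincomb G us (map2 (\<lambda>c d. (d - c) mod int p) cs ds) = lincomb G us ds"
  using assms(2,1)
proof (induction cs ds arbitrary: us rule: list_induct2)
  case Nil
  then show ?case by (cases us) auto
next
  case (Cons c cs d ds)
  show ?case
  proof (cases us)
    case (Cons u us')
    let ?es = "map2 (\<lambda>c d. (d - c) mod int p) cs ds"
    have u: "u \<in> carrier G" "set us' \<subseteq> carrier G"
      using Cons Cons.prems by auto
    have "(u [^] c \<otimes> lincomb G us' cs) \<otimes> (u [^] (d - c) \<otimes> lincomb G us' ?es) =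
      (u [^] c \<otimes> u [^] (d - c)) \<otimes> (lincomb G us' cs \<otimes> lincomb G us' ?es)"
      using u by (simp add: m_ac)
    also have "\<dots> = u [^] d \<otimes> lincomb G us' ds"
      using u Cons.IH[OF u(2)] by (simp add: int_pow_mult[symmetric])
    finally show ?thesis
      using Cons u by (simp add: int_pow_mod)
  qed simp
qed

section \<open>Coefficient vectors modulo p and the random affine map\<close>

abbreviation "coeff_lists k \<equiv> nlists k {0..<int p}"

lemma p_pos: "0 < int p"
  using prime_p prime_gt_0_nat by simp

lemma coeff_lists_fin: "finite (coeff_lists k)" "coeff_lists k \<noteq> {}"
  using p_pos by (auto intro!: finite_nlists nlists_nonempty)

lemma card_coeff_lists: "card (coeff_lists k) = p ^ k"
  by (simp add: card_nlists)

lemma diff_mod_eq_iff: "\<lbrakk>c \<in> {0..<int p}; d \<in> {0..<int p}\<rbrakk> \<Longrightarrow> int p dvd (d - c) mod int p \<longleftrightarrow> c = d"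
  by (auto simp: mod_eq_0_iff_dvd mod_eq_dvd_iff[symmetric] dvd_mod_iff)

lemma coeff_lists_diff_nonzero:
  assumes "a \<in> coeff_lists k" "b \<in> coeff_lists k" "a \<noteq> b"
  shows "\<exists>c\<in>set (map2 (\<lambda>c d. (d - c) mod int p) a b). \<not> int p dvd c"
proof -
  have "length a = length b" using assms by simp
  then show ?thesis
    using nlistsE_set[OF assms(1)] nlistsE_set[OF assms(2)] assms(3)
  proof (induction a b rule: list_induct2)
    case (Cons x xs y ys)
    then show ?case
      by (cases "x = y") (auto simp: diff_mod_eq_iff)
  qed simp
qed

lemma avg_affine:
  assumes "length a = k"
  shows "avg (nlists (Suc k) (carrier G)) (\<lambda>us. F (lincomb G us (1 # a))) = avg (carrier G) F"
proof (rule avg_lincomb)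
  have "\<not> p dvd 1"
    using prime_p by (metis not_prime_unit)
  then show "\<exists>c\<in>set (1 # a). \<not> int p dvd c" by simp
qed (use assms in simp)

text \<open>Pairwise independence. Translating \<open>u\<close> makes the first point
  \<open>u\<close> itself; the second is then \<open>u\<close> times a combination with coefficients
  \<open>b - a\<close>, a nonzero vector, hence uniform and independent of \<open>u\<close>.\<close>

lemma avg_affine_pair:
  assumes "a \<in> coeff_lists k" "b \<in> coeff_lists k" "a \<noteq> b"
  shows "avg (nlists (Suc k) (carrier G)) (\<lambda>us. F (lincomb G us (1 # a)) * F' (lincomb G us (1 # b))) =
    avg (carrier G) F * avg (carrier G) F'"
proof -
  let ?C = "carrier G"
  let ?d = "map2 (\<lambda>c d. (d - c) mod int p) a b"
  have "avg (nlists (Suc k) ?C) (\<lambda>us. F (lincomb G us (1 # a)) * F' (lincomb G us (1 # b))) =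
    avg (nlists k ?C) (\<lambda>us. avg ?C (\<lambda>u. F (u \<otimes> lincomb G us a) * F' (u \<otimes> lincomb G us b)))"
    by (subst avg_swap) (auto simp: avg_nlists_Suc intro!: avg_cong)
  also have "\<dots> = avg (nlists k ?C) (\<lambda>us. avg ?C (\<lambda>u. F u * F' (u \<otimes> lincomb G us ?d)))"
  proof (rule avg_cong)
    fix us assume "us \<in> nlists k ?C"
    then have us: "set us \<subseteq> ?C" by simp
    have "avg ?C (\<lambda>u. F u * F' (u \<otimes> lincomb G us ?d)) =
      avg ?C (\<lambda>u. F (u \<otimes> lincomb G us a) * F' ((u \<otimes> lincomb G us a) \<otimes> lincomb G us ?d))"
      using us by (intro avg_reindex[OF bij_betw_mult_right, symmetric]) auto
    also have "\<dots> = avg ?C (\<lambda>u. F (u \<otimes> lincomb G us a) * F' (u \<otimes> lincomb G us b))"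
      using us assms lincomb_diff[OF us, of a b] by (intro avg_cong) (auto simp: m_assoc)
    finally show "avg ?C (\<lambda>u. F (u \<otimes> lincomb G us a) * F' (u \<otimes> lincomb G us b)) =
      avg ?C (\<lambda>u. F u * F' (u \<otimes> lincomb G us ?d))" ..
  qed simp
  also have "\<dots> = avg ?C (\<lambda>u. F u * avg (nlists k ?C) (\<lambda>us. F' (u \<otimes> lincomb G us ?d)))"
    by (subst avg_swap) (simp add: avg_cmult)
  also have "\<dots> = avg ?C (\<lambda>u. F u * avg ?C F')"
  proof (rule avg_cong)
    fix u assume u: "u \<in> ?C"
    have "avg (nlists k ?C) (\<lambda>us. F' (u \<otimes> lincomb G us ?d)) = avg ?C (\<lambda>z. F' (u \<otimes> z))"
      using assms coeff_lists_diff_nonzero by (intro avg_lincomb) auto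
    then show "F u * avg (nlists k ?C) (\<lambda>us. F' (u \<otimes> lincomb G us ?d)) = F u * avg ?C F'"
      using avg_reindex[OF bij_betw_mult_left[OF u], of F'] by simp
  qed simp
  finally show ?thesis by (simp add: avg_multc)
qed

text \<open>The leading coefficient \<open>0\<close> removes the translation by the first reserve
  point, so this is the kernel size of the linear part divided by \<open>p ^ k\<close>.\<close>

definition kernel_density :: "nat \<Rightarrow> 'a list \<Rightarrow> real" where
  "kernel_density k us = avg (coeff_lists k) (\<lambda>d. of_bool (lincomb G us (0 # d) = \<one>))"

lemma kernel_density_nonneg: "0 \<le> kernel_density k us"
  unfolding kernel_density_def by (intro avg_nonneg) simp

text \<open>A nonempty fibre of an affine map is a translate of the kernel: subtracting a fixed
  solution \<open>b\<close> modulo \<open>p\<close> maps it injectively into the kernel. The factor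
  \<open>y\<close> lets the bound serve both kinds of late queries.\<close>

lemma avg_affine_fibre_le:
  assumes us: "us \<in> nlists (Suc k) (carrier G)" and y: "y \<in> carrier G"
  shows "avg (coeff_lists k) (\<lambda>a. of_bool (y \<otimes> lincomb G us (1 # a) = z)) \<le> kernel_density k us"
proof (cases "\<exists>a\<in>coeff_lists k. y \<otimes> lincomb G us (1 # a) = z")
  case True
  then obtain b where b: "b \<in> coeff_lists k" "y \<otimes> lincomb G us (1 # b) = z" by blast
  let ?\<phi> = "map2 (\<lambda>c d. (d - c) mod int p) b"
  have us': "set us \<subseteq> carrier G" using us by simp
  have "card {a \<in> coeff_lists k. y \<otimes> lincomb G us (1 # a) = z} \<le>
    card {d \<in> coeff_lists k. lincomb G us (0 # d) = \<one>}"
  proof (rule card_inj_on_le)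
    show "inj_on ?\<phi> {a \<in> coeff_lists k. y \<otimes> lincomb G us (1 # a) = z}"
    proof (rule inj_onI, clarify)
      fix a a' assume "a \<in> coeff_lists k" "a' \<in> coeff_lists k" "?\<phi> a = ?\<phi> a'"
      moreover have "a ! i = a' ! i" if i: "i < k" for i
      proof -
        have "a ! i \<in> {0..<int p}" "a' ! i \<in> {0..<int p}"
          using \<open>a \<in> coeff_lists k\<close> \<open>a' \<in> coeff_lists k\<close> i by (auto dest!: nlistsE_nth_in)
        moreover have "(a ! i - b ! i) mod int p = (a' ! i - b ! i) mod int p"
          using arg_cong[OF \<open>?\<phi> a = ?\<phi> a'\<close>, of "\<lambda>l. l ! i"] i b(1) \<open>a \<in> coeff_lists k\<close> \<open>a' \<in> coeff_lists k\<close>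
          by simp
        ultimately show ?thesis
          by (auto simp: mod_eq_dvd_iff) (metis mod_eq_dvd_iff mod_pos_pos_trivial)
      qed
      ultimately show "a = a'"
        by (intro nth_equalityI) auto
    qed
    show "?\<phi> ` {a \<in> coeff_lists k. y \<otimes> lincomb G us (1 # a) = z} \<subseteq>
      {d \<in> coeff_lists k. lincomb G us (0 # d) = \<one>}"
    proof clarify
      fix a assume a: "a \<in> coeff_lists k" "z = y \<otimes> lincomb G us (1 # a)"
      have "y \<otimes> lincomb G us (1 # b) = y \<otimes> lincomb G us (1 # a)"
        using a b by simp
      then have eq: "lincomb G us (1 # b) = lincomb G us (1 # a)"
        using y us' by simp
      have "lincomb G us (1 # b) \<otimes> lincomb G us (0 # ?\<phi> a) = lincomb G us (1 # a)"
        using lincomb_diff[OF us', of "1 # b" "1 # a"] a b by simp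
      then have "lincomb G us (0 # ?\<phi> a) = \<one>"
        using eq us' by (metis l_cancel_one' lincomb_closed)
      moreover have "?\<phi> a \<in> coeff_lists k"
        using a b p_pos by (intro nlistsI) (auto simp: set_zip)
      ultimately show "?\<phi> a \<in> coeff_lists k \<and> lincomb G us (0 # ?\<phi> a) = \<one>" by simp
    qed
  qed (simp add: coeff_lists_fin)
  then show ?thesis
    by (simp add: kernel_density_def avg_of_bool_card coeff_lists_fin divide_right_mono)
next
  case False
  then have "avg (coeff_lists k) (\<lambda>a. of_bool (y \<otimes> lincomb G us (1 # a) = z)) \<le> 0"
    using coeff_lists_fin by (intro avg_le_const) auto
  then show ?thesis
    using kernel_density_nonneg by (rule order_trans)
qed

text \<open>The zero vector always lies in the kernel and contributes \<open>1 / p ^ k\<close>. Any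
  other vector is sent to a uniform element, which is \<open>\<one>\<close> with probability
  \<open>1 / N\<close>.\<close>

lemma avg_kernel_density_le:
  "avg (nlists (Suc k) (carrier G)) (kernel_density k) \<le> 1 / real p ^ k + 1 / N"
proof -
  have "avg (nlists (Suc k) (carrier G)) (kernel_density k) =
    avg (coeff_lists k) (\<lambda>d. avg (nlists (Suc k) (carrier G)) (\<lambda>us. of_bool (lincomb G us (0 # d) = \<one>)))"
    unfolding kernel_density_def by (rule avg_swap)
  also have "\<dots> \<le> avg (coeff_lists k) (\<lambda>d. of_bool (d = replicate k 0) + 1 / N)"
  proof (rule avg_mono)
    fix d assume d: "d \<in> coeff_lists k"
    show "avg (nlists (Suc k) (carrier G)) (\<lambda>us. of_bool (lincomb G us (0 # d) = \<one>)) \<le>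
      of_bool (d = replicate k 0) + 1 / N"
    proof (cases "d = replicate k 0")
      case True
      then show ?thesis
        using avg_of_bool_le_1[of "nlists (Suc k) (carrier G)"] fin carrier_ne N_pos
        by (simp add: finite_nlists nlists_nonempty add_increasing2)
    next
      case False
      have "\<exists>c\<in>set d. \<not> int p dvd c"
      proof (rule ccontr)
        assume *: "\<not> ?thesis"
        have "c = 0" if "c \<in> set d" for c
        proof -
          have "0 \<le> c" "c < int p" using that nlistsE_set[OF d] by auto
          moreover have "int p dvd c" using * that by blast
          ultimately show ?thesis
            by (metis dvd_imp_mod_0 mod_pos_pos_trivial)
        qed
        then show False
          using False d by (metis nlistsE_length replicate_eqI)
      qed
      then have "avg (nlists (Suc k) (carrier G)) (\<lambda>us. of_bool (lincomb G us (0 # d) = \<one>)) =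
        avg (carrier G) (\<lambda>z. of_bool (z = \<one>))"
        using d by (intro avg_lincomb) auto
      also have "\<dots> = 1 / N"
        using fin by (simp add: avg_def of_bool_def)
      finally show ?thesis using False by simp
    qed
  qed
  also have "\<dots> = 1 / real p ^ k + 1 / N"
  proof -
    have "{d \<in> coeff_lists k. d = replicate k 0} = {replicate k 0}"
      using p_pos by (auto intro: nlists_replicateI)
    then show ?thesis
      by (simp add: avg_add avg_const avg_of_bool_card coeff_lists_fin card_coeff_lists)
  qed
  finally show ?thesis .
qed

end

section \<open>Linearity testing without an adversary\<close>

definition BLR_defect :: "('a, 'm) monoid_scheme \<Rightarrow> ('b, 'k) monoid_scheme \<Rightarrow> ('a \<Rightarrow> 'b) \<Rightarrow> real" where
  "BLR_defect G H f = avg (carrier G) (\<lambda>x. avg (carrier G)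
     (\<lambda>y. of_bool (f x \<otimes>\<^bsub>H\<^esub> f y \<noteq> f (x \<otimes>\<^bsub>G\<^esub> y))))"

text \<open>Self-correction by voting. The threshold \<open>1/6\<close> makes three exceptional
  events of probability \<open>2 * \<delta>\<close> avoidable at once, which gives multiplicativity
  of \<open>h\<close>; the factor \<open>3/2\<close> is a bound for
  \<open>1 / (1 - 2 * \<delta>)\<close>.\<close>

lemma BLR:
  fixes G :: "('a, 'm) monoid_scheme" (structure) and H :: "('b, 'k) monoid_scheme"
  assumes "comm_group G" "comm_group H" "finite (carrier G)"
    and f: "f \<in> carrier G \<rightarrow> carrier H"
    and small: "BLR_defect G H f < 1/6"
  shows "\<exists>h\<in>hom G H. avg (carrier G) (\<lambda>x. of_bool (f x \<noteq> h x)) \<le> 3/2 * BLR_defect G H f"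
proof -
  interpret G: comm_group G by fact
  interpret H: comm_group H by fact
  let ?C = "carrier G"
  define \<delta> where "\<delta> = BLR_defect G H f"
  have C: "finite ?C" "?C \<noteq> {}" using assms by auto
  have f': "f x \<in> carrier H" if "x \<in> ?C" for x using f that by auto
  \<comment> \<open>The value that \<open>y\<close> votes for as the corrected value of \<open>f\<close> at \<open>x\<close>.  Two random votes
    agree except with probability \<open>2 * \<delta>\<close>, so some value \<open>h x\<close> receives almost all of them.\<close>
  define D where "D x y = f (x \<otimes> y) \<otimes>\<^bsub>H\<^esub> inv\<^bsub>H\<^esub> f y" for x y
  have D: "D x y \<in> carrier H" if "x \<in> ?C" "y \<in> ?C" for x y
    using that f' by (simp add: D_def)
  have D_collision: "avg ?C (\<lambda>y'. avg ?C (\<lambda>y. of_bool (D x y \<noteq> D x y'))) \<le> 2 * \<delta>" if x: "x \<in> ?C" for x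
  proof -
    let ?B = "\<lambda>y y'. of_bool (f (x \<otimes> y) \<otimes>\<^bsub>H\<^esub> f y' \<noteq> f (x \<otimes> y \<otimes> y')) :: real"
    have "avg ?C (\<lambda>y'. avg ?C (\<lambda>y. of_bool (D x y \<noteq> D x y'))) \<le>
      avg ?C (\<lambda>y'. avg ?C (\<lambda>y. ?B y y' + ?B y' y))"
    proof (intro avg_mono)
      fix y' y assume y: "y' \<in> ?C" "y \<in> ?C"
      \<comment> \<open>Both test identities have the same right-hand side by commutativity.
        Equating their left-hand sides and cancelling \<open>f y\<close> and \<open>f y'\<close>
        gives equal votes.\<close>
      have "D x y = D x y'" if "f (x \<otimes> y) \<otimes>\<^bsub>H\<^esub> f y' = f (x \<otimes> y \<otimes> y')"
        "f (x \<otimes> y') \<otimes>\<^bsub>H\<^esub> f y = f (x \<otimes> y' \<otimes> y)"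
      proof -
        have eq: "f (x \<otimes> y) \<otimes>\<^bsub>H\<^esub> f y' = f (x \<otimes> y') \<otimes>\<^bsub>H\<^esub> f y"
          using that x y by (simp add: G.m_ac)
        have "D x y = (f (x \<otimes> y) \<otimes>\<^bsub>H\<^esub> f y') \<otimes>\<^bsub>H\<^esub> (inv\<^bsub>H\<^esub> f y' \<otimes>\<^bsub>H\<^esub> inv\<^bsub>H\<^esub> f y)"
          using x y f' by (simp add: D_def H.m_assoc H.m_assoc[symmetric, of "f y'"])
        also have "\<dots> = (f (x \<otimes> y') \<otimes>\<^bsub>H\<^esub> f y) \<otimes>\<^bsub>H\<^esub> (inv\<^bsub>H\<^esub> f y \<otimes>\<^bsub>H\<^esub> inv\<^bsub>H\<^esub> f y')"
          using x y f' eq by (simp add: H.m_comm)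
        also have "\<dots> = D x y'"
          using x y f' by (simp add: D_def H.m_assoc H.m_assoc[symmetric, of "f y"])
        finally show ?thesis .
      qed
      then show "of_bool (D x y \<noteq> D x y') \<le> ?B y y' + ?B y' y" by auto
    qed
    also have "\<dots> = avg ?C (\<lambda>y'. avg ?C (\<lambda>y. ?B y y')) + avg ?C (\<lambda>y'. avg ?C (\<lambda>y. ?B y' y))"
      by (simp add: avg_add)
    also have "avg ?C (\<lambda>y'. avg ?C (\<lambda>y. ?B y y')) = avg ?C (\<lambda>y'. avg ?C (\<lambda>y. ?B y' y))"
      by (rule avg_swap)
    also have "avg ?C (\<lambda>y. avg ?C (\<lambda>y'. ?B y y')) = \<delta>"
      unfolding \<delta>_def BLR_defect_def by (rule avg_reindex[OF G.bij_betw_mult_left[OF x]])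
    finally show ?thesis by simp
  qed
  \<comment> \<open>The witness is the vote of some \<open>y'\<close> whose disagreement probability
    does not exceed the average.\<close>
  have "\<exists>v\<in>carrier H. avg ?C (\<lambda>y. of_bool (D x y \<noteq> v)) \<le> 2 * \<delta>" if x: "x \<in> ?C" for x
    using avg_le_exists[OF C D_collision[OF x]] D[OF x] by blast
  then obtain h where h: "\<And>x. x \<in> ?C \<Longrightarrow> h x \<in> carrier H"
    "\<And>x. x \<in> ?C \<Longrightarrow> avg ?C (\<lambda>y. of_bool (D x y \<noteq> h x)) \<le> 2 * \<delta>"
    by metis
  have "h (x \<otimes> z) = h x \<otimes>\<^bsub>H\<^esub> h z" if xz: "x \<in> ?C" "z \<in> ?C" for x z
  proof -
    have "avg ?C (\<lambda>y. of_bool (D z y \<noteq> h z) + (of_bool (D x (z \<otimes> y) \<noteq> h x) + of_bool (D (x \<otimes> z) y \<noteq> h (x \<otimes> z)))) \<le>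
      2 * \<delta> + (2 * \<delta> + 2 * \<delta>)"
      unfolding avg_add
      using xz h(2)[of z] h(2)[of "x \<otimes> z"] h(2)[of x]
        avg_reindex[OF G.bij_betw_mult_left[of z], of "\<lambda>y. of_bool (D x y \<noteq> h x)"]
      by (intro add_mono) auto
    from avg_le_exists[OF C this] obtain y where y: "y \<in> ?C"
      "of_bool (D z y \<noteq> h z) + (of_bool (D x (z \<otimes> y) \<noteq> h x) + of_bool (D (x \<otimes> z) y \<noteq> h (x \<otimes> z))) \<le> 6 * \<delta>"
      by auto
    \<comment> \<open>The sum of the three indicators is a natural number and
      \<open>6 * \<delta> < 1\<close>, so all three vanish.\<close>
    then have "D z y = h z \<and> D x (z \<otimes> y) = h x \<and> D (x \<otimes> z) y = h (x \<otimes> z)"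
      using small by (auto simp: \<delta>_def of_bool_def split: if_splits)
    \<comment> \<open>Telescoping: the value \<open>f (z \<otimes> y)\<close> cancels.\<close>
    moreover have "D (x \<otimes> z) y = D x (z \<otimes> y) \<otimes>\<^bsub>H\<^esub> D z y"
      using xz y f' by (simp add: D_def G.m_assoc H.m_assoc H.m_assoc[symmetric, of "inv\<^bsub>H\<^esub> f (z \<otimes> y)"])
    ultimately show ?thesis by metis
  qed
  then have hom: "h \<in> hom G H"
    using h(1) by (auto simp: hom_def)
  \<comment> \<open>Where \<open>f x\<close> differs from \<open>h x\<close>, every \<open>y\<close>
    voting for \<open>h x\<close> violates the test at \<open>(x, y)\<close>, since a passed test is
    a vote for \<open>f x\<close>.\<close>
  have "(1 - 2 * \<delta>) * of_bool (f x \<noteq> h x) \<le> avg ?C (\<lambda>y. of_bool (f x \<otimes>\<^bsub>H\<^esub> f y \<noteq> f (x \<otimes> y)))"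
    if x: "x \<in> ?C" for x
  proof (cases "f x = h x")
    case True
    then show ?thesis by (auto intro: avg_nonneg)
  next
    case False
    have "1 - 2 * \<delta> \<le> avg ?C (\<lambda>y. of_bool (\<not> D x y \<noteq> h x))"
      using h(2)[OF x] C by (subst avg_of_bool_not) auto
    also have "\<dots> \<le> avg ?C (\<lambda>y. of_bool (f x \<otimes>\<^bsub>H\<^esub> f y \<noteq> f (x \<otimes> y)))"
    proof (rule avg_mono)
      fix y assume y: "y \<in> ?C"
      have "D x y = f x" if "f x \<otimes>\<^bsub>H\<^esub> f y = f (x \<otimes> y)"
        unfolding D_def that[symmetric] using x y f' by (simp add: H.m_assoc)
      then show "of_bool (\<not> D x y \<noteq> h x) \<le> (of_bool (f x \<otimes>\<^bsub>H\<^esub> f y \<noteq> f (x \<otimes> y)) :: real)"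
        using False by auto
    qed
    finally show ?thesis using False by simp
  qed
  then have "avg ?C (\<lambda>x. (1 - 2 * \<delta>) * of_bool (f x \<noteq> h x)) \<le> \<delta>"
    unfolding \<delta>_def BLR_defect_def by (intro avg_mono) (simp add: \<delta>_def BLR_defect_def)
  then have "(1 - 2 * \<delta>) * avg ?C (\<lambda>x. of_bool (f x \<noteq> h x)) \<le> \<delta>"
    by (simp add: avg_cmult)
  moreover have "2/3 * avg ?C (\<lambda>x. of_bool (f x \<noteq> h x)) \<le> (1 - 2 * \<delta>) * avg ?C (\<lambda>x. of_bool (f x \<noteq> h x))"
    using small by (intro mult_right_mono avg_nonneg) (auto simp: \<delta>_def)
  ultimately show ?thesis
    using hom unfolding \<delta>_def by (intro bexI[of _ h]) auto
qed

text \<open>Below \<open>1/6\<close>, \<open>BLR\<close> provides a homomorphism within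
  \<open>3/2\<close> of the defect, so a defect under \<open>\<epsilon> / 6\<close> would contradict
  farness. The constant 6 is dictated by that threshold, as \<open>\<epsilon> < 1\<close>.\<close>

lemma BLR_defect_of_far:
  fixes G :: "('a, 'm) monoid_scheme" and H :: "('b, 'k) monoid_scheme"
  assumes "comm_group G" "comm_group H" "finite (carrier G)" "f \<in> carrier G \<rightarrow> carrier H"
    and "eps_far_from_hom G H \<epsilon> f" "0 < \<epsilon>" "\<epsilon> < 1"
  shows "\<epsilon> / 6 \<le> BLR_defect G H f"
proof (rule ccontr)
  assume small: "\<not> ?thesis"
  then have "BLR_defect G H f < 1/6" using assms by simp
  from BLR[OF assms(1-4) this] obtain h where h: "h \<in> hom G H"
    "avg (carrier G) (\<lambda>x. of_bool (f x \<noteq> h x)) \<le> 3/2 * BLR_defect G H f" by blast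
  interpret comm_group G by fact
  have "carrier G \<noteq> {}" by blast
  then have "\<epsilon> < avg (carrier G) (\<lambda>x. of_bool (f x \<noteq> h x))"
    using assms(3,5) h(1) prob_pmf_of_set_eq_avg[of "carrier G" "\<lambda>x. f x \<noteq> h x"]
    unfolding eps_far_from_hom_def by metis
  then show False using h(2) small assms by simp
qed

context exponent_p_group
begin

text \<open>Chebyshev for \<open>p ^ k\<close> pairwise independent samples. In the second moment
  the off-diagonal pairs give \<open>\<delta>\<^sup>2\<close> each, and the diagonal adds at most
  \<open>\<delta> / p ^ k\<close> because \<open>\<phi>\<close> is bounded by 1. The variance is
  then compared with the squared deviation \<open>(\<delta> / 2)\<^sup>2\<close>.\<close>

lemma affine_concentration:
  assumes \<phi>: "\<And>x. x \<in> carrier G \<Longrightarrow> 0 \<le> \<phi> x \<and> \<phi> x \<le> 1"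
    and \<delta>: "avg (carrier G) \<phi> = \<delta>" "0 < \<delta>"
  shows "avg (nlists (Suc k) (carrier G))
    (\<lambda>us. of_bool (avg (coeff_lists k) (\<lambda>a. \<phi> (lincomb G us (1 # a))) < \<delta> / 2)) \<le> 4 / (real p ^ k * \<delta>)"
proof -
  let ?U = "nlists (Suc k) (carrier G)" and ?K = "coeff_lists k"
  define S where "S us = avg ?K (\<lambda>a. \<phi> (lincomb G us (1 # a)))" for us
  have U: "finite ?U" "?U \<noteq> {}" using fin carrier_ne by (auto intro!: finite_nlists nlists_nonempty)
  have P: "0 < real p ^ k" using p_pos by simp
  have "avg ?U S = avg ?K (\<lambda>a. avg ?U (\<lambda>us. \<phi> (lincomb G us (1 # a))))"
    unfolding S_def by (rule avg_swap)
  also have "\<dots> = avg ?K (\<lambda>a. \<delta>)"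
    using \<delta> by (intro avg_cong) (auto simp: avg_affine)
  finally have ES: "avg ?U S = \<delta>"
    by (simp add: avg_const coeff_lists_fin)
  have sq: "S us ^ 2 = avg ?K (\<lambda>a. avg ?K (\<lambda>b. \<phi> (lincomb G us (1 # a)) * \<phi> (lincomb G us (1 # b))))" for us
    by (simp add: S_def power2_eq_square avg_cmult avg_multc)
  have "avg ?U (\<lambda>us. S us ^ 2) = avg ?K (\<lambda>a. avg ?K (\<lambda>b. avg ?U
      (\<lambda>us. \<phi> (lincomb G us (1 # a)) * \<phi> (lincomb G us (1 # b)))))"
    unfolding sq by (subst avg_swap) (subst avg_swap, rule refl)
  also have "\<dots> \<le> avg ?K (\<lambda>a. avg ?K (\<lambda>b. \<delta>\<^sup>2 + \<delta> * of_bool (b = a)))"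
  proof (intro avg_mono)
    fix a b assume ab: "a \<in> ?K" "b \<in> ?K"
    show "avg ?U (\<lambda>us. \<phi> (lincomb G us (1 # a)) * \<phi> (lincomb G us (1 # b))) \<le> \<delta>\<^sup>2 + \<delta> * of_bool (b = a)"
    proof (cases "b = a")
      case True
      have "avg ?U (\<lambda>us. \<phi> (lincomb G us (1 # a)) * \<phi> (lincomb G us (1 # b))) \<le>
        avg ?U (\<lambda>us. \<phi> (lincomb G us (1 # a)))"
        using \<phi> True by (intro avg_mono) (auto intro!: mult_left_le)
      also have "\<dots> = \<delta>" using ab \<delta> by (simp add: avg_affine)
      finally show ?thesis using True by (simp add: add_increasing)
    next
      case False
      then show ?thesis using ab \<delta> avg_affine_pair[OF ab] by (simp add: power2_eq_square)
    qed
  qed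
  also have "\<dots> = avg ?K (\<lambda>a. \<delta>\<^sup>2 + \<delta> / real p ^ k)"
  proof (intro avg_cong refl)
    fix a assume "a \<in> ?K"
    then have "{b \<in> ?K. b = a} = {a}" by auto
    then show "avg ?K (\<lambda>b. \<delta>\<^sup>2 + \<delta> * of_bool (b = a)) = \<delta>\<^sup>2 + \<delta> / real p ^ k"
      by (simp add: avg_add avg_cmult avg_const avg_of_bool_card coeff_lists_fin card_coeff_lists)
  qed
  finally have ES2: "avg ?U (\<lambda>us. S us ^ 2) \<le> \<delta>\<^sup>2 + \<delta> / real p ^ k"
    by (simp add: avg_const coeff_lists_fin)
  have "avg ?U (\<lambda>us. (S us - \<delta>)\<^sup>2) = avg ?U (\<lambda>us. (S us ^ 2 - 2 * \<delta> * S us) + \<delta>\<^sup>2)"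
    by (simp add: power2_eq_square algebra_simps)
  also have "\<dots> = avg ?U (\<lambda>us. S us ^ 2) - 2 * \<delta> * avg ?U S + \<delta>\<^sup>2"
    using U by (simp add: avg_add avg_diff avg_cmult avg_const)
  also have "\<dots> \<le> \<delta> / real p ^ k"
    using ES ES2 by (simp add: power2_eq_square)
  finally have var: "avg ?U (\<lambda>us. (S us - \<delta>)\<^sup>2) \<le> \<delta> / real p ^ k" .
  have "avg ?U (\<lambda>us. of_bool (S us < \<delta> / 2)) \<le> avg ?U (\<lambda>us. 4 / \<delta>\<^sup>2 * (S us - \<delta>)\<^sup>2)"
  proof (rule avg_mono)
    fix us
    have "(\<delta> / 2)\<^sup>2 \<le> (\<delta> - S us)\<^sup>2" if "S us < \<delta> / 2"
      using that \<delta> by (intro power_mono) auto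
    then show "of_bool (S us < \<delta> / 2) \<le> 4 / \<delta>\<^sup>2 * (S us - \<delta>)\<^sup>2"
      using \<delta>(2) by (auto simp: field_simps power2_commute)
  qed
  also have "\<dots> \<le> 4 / \<delta>\<^sup>2 * (\<delta> / real p ^ k)"
    unfolding avg_cmult using var by (intro mult_left_mono) auto
  also have "\<dots> = 4 / (real p ^ k * \<delta>)"
    using \<delta>(2) by (simp add: power2_eq_square)
  finally show ?thesis by (simp add: S_def)
qed

end

section \<open>Queries under manipulation\<close>

text \<open>Non-adaptive trees: the query points are fixed and only the verdict sees the
  answers.\<close>

primrec ask :: "'x list \<Rightarrow> ('y option list \<Rightarrow> bool) \<Rightarrow> ('x, 'y) query_tree" where
  "ask [] V = Verdict (V [])"
| "ask (x # xs) V = Query x (\<lambda>a. ask xs (\<lambda>as. V (a # as)))"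

primrec answers :: "('x, 'y) strategy \<Rightarrow> 'x list \<Rightarrow> 'x list \<Rightarrow> 'y option list" where
  "answers A qs [] = []"
| "answers A qs (x # xs) = A qs x # answers A (qs @ [x]) xs"

lemma accepts_ask: "accepts (ask xs V) A qs = V (answers A qs xs)"
  by (induction xs arbitrary: V qs) auto

lemma query_count_ask: "query_count (ask xs V) A qs = length xs"
  by (induction xs arbitrary: V qs) auto

lemma query_points_ask: "query_points (ask xs V) = set xs"
  by (induction xs arbitrary: V) auto

text \<open>The comparison is with the input \<open>f\<close>, not with the preceding state, so a
  restored point drops out. An answer can be wrong only at a point of this set.\<close>

definition manipulated :: "'x set \<Rightarrow> ('x \<Rightarrow> 'y) \<Rightarrow> ('x, 'y) strategy \<Rightarrow> 'x list \<Rightarrow> 'x set" where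
  "manipulated X f A qs = {z\<in>X. A qs z \<noteq> Some (f z)}"

lemma answers_eq_of_not_hits:
  "set xs \<subseteq> X \<Longrightarrow> \<not> hits (manipulated X f A) qs xs \<Longrightarrow> answers A qs xs = map (\<lambda>x. Some (f x)) xs"
  by (induction xs arbitrary: qs) (auto simp: manipulated_def)

text \<open>A point untouched in every round keeps its initial value, so each manipulated point was
  paid for in some round. It does not matter when the budget is spent or on which values.\<close>

lemma card_manipulated_le:
  assumes "budget_managing X V t f A" "finite X" "qs \<in> lists X"
  shows "real (card (manipulated X f A qs)) \<le> t * real (length qs)"
proof -
  let ?\<Delta> = "\<lambda>i. {z\<in>X. A (take (Suc i) qs) z \<noteq> A (take i qs) z}"
  have "manipulated X f A qs \<subseteq> (\<Union>i<length qs. ?\<Delta> i)"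
  proof
    fix z assume z: "z \<in> manipulated X f A qs"
    show "z \<in> (\<Union>i<length qs. ?\<Delta> i)"
    proof (rule ccontr)
      assume *: "z \<notin> (\<Union>i<length qs. ?\<Delta> i)"
      have "A (take i qs) z = Some (f z)" if "i \<le> length qs" for i
        using that
      proof (induction i)
        case 0
        then show ?case using assms(1) z by (auto simp: budget_managing_def manipulated_def)
      next
        case (Suc i)
        then show ?case using * z by (auto simp: manipulated_def)
      qed
      from this[of "length qs"] show False using z by (simp add: manipulated_def)
    qed
  qed
  then have "card (manipulated X f A qs) \<le> card (\<Union>i<length qs. ?\<Delta> i)"
    using assms(2) by (intro card_mono) auto
  also have "\<dots> \<le> (\<Sum>i<length qs. card (?\<Delta> i))"
    by (rule card_UN_le) simp
  finally have "real (card (manipulated X f A qs)) \<le> real (\<Sum>i<length qs. card (?\<Delta> i))"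
    by (rule of_nat_mono)
  also have "\<dots> \<le> t * real (length qs)"
    using assms(1,3) by (simp add: budget_managing_def)
  finally show ?thesis .
qed

text \<open>Every change leads to \<open>None\<close>, so no false value ever arises. This is the
  source of the one-sided error.\<close>

lemma erasure_value:
  assumes "budget_managing X {None} t f A" "qs \<in> lists X" "z \<in> X"
  shows "A qs z = None \<or> A qs z = Some (f z)"
  using assms(2)
proof (induction qs rule: rev_induct)
  case Nil
  then show ?case using assms by (simp add: budget_managing_def)
next
  case (snoc x qs)
  then have "A (qs @ [x]) z \<noteq> A qs z \<longrightarrow> A (qs @ [x]) z = None"
    using assms(1,3) by (simp add: budget_managing_def)
  then show ?case using snoc by auto
qed

lemma erasure_answers:
  assumes "budget_managing X {None} t f A" "set xs \<subseteq> X" "qs \<in> lists X"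
  shows "list_all2 (\<lambda>x a. a = None \<or> a = Some (f x)) xs (answers A qs xs)"
  using assms(2,3)
  by (induction xs arbitrary: qs) (auto simp: erasure_value[OF assms(1)])

text \<open>The tester's coins are independent of the adversary's, so a bound against each pure
  strategy passes to randomized adversaries by integration.\<close>

lemma prob_pair_pmf_ge:
  assumes "\<And>y. y \<in> set_pmf N \<Longrightarrow> c \<le> measure_pmf.prob M {x. Q x y}"
  shows "c \<le> measure_pmf.prob (pair_pmf M N) {(x, y). Q x y}"
proof -
  let ?S = "{(x, y). Q x y}"
  have "ennreal c = (\<integral>\<^sup>+y. ennreal c \<partial>measure_pmf N)"
    by (simp add: measure_pmf.emeasure_space_1)
  also have "\<dots> \<le> (\<integral>\<^sup>+y. emeasure (measure_pmf M) {x. Q x y} \<partial>measure_pmf N)"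
    using assms by (intro nn_integral_mono_AE)
      (auto simp: AE_measure_pmf_iff measure_pmf.emeasure_eq_measure intro!: ennreal_leI)
  also have "\<dots> = (\<integral>\<^sup>+y. \<integral>\<^sup>+x. indicator ?S (x, y) \<partial>measure_pmf M \<partial>measure_pmf N)"
    by (intro nn_integral_cong) (simp add: nn_integral_indicator[symmetric] indicator_def del: nn_integral_indicator)
  also have "\<dots> = (\<integral>\<^sup>+z. indicator ?S (snd z, fst z) \<partial>measure_pmf (pair_pmf N M))"
    by (simp add: nn_integral_pair_pmf')
  also have "\<dots> = (\<integral>\<^sup>+z. indicator ?S z \<partial>measure_pmf (pair_pmf M N))"
    by (subst pair_commute_pmf[of M]) (simp add: case_prod_unfold)
  also have "\<dots> = ennreal (measure_pmf.prob (pair_pmf M N) ?S)"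
    by (simp add: measure_pmf.emeasure_eq_measure)
  finally show ?thesis by (simp add: ennreal_le_iff)
qed

text \<open>Erased answers impose no constraint on \<open>h\<close>, which lets one verdict rule
  serve erasures and corruptions alike.\<close>

definition hom_query ::
    "('x, 'm) monoid_scheme \<Rightarrow> ('y, 'k) monoid_scheme \<Rightarrow> 'x list \<Rightarrow> ('x, 'y) query_tree" where
  "hom_query G H xs =
     ask xs (\<lambda>as. \<exists>h\<in>hom G H. list_all2 (\<lambda>x a. a = None \<or> a = Some (h x)) xs as)"

lemma accepts_hom_query_of_not_hits:
  assumes "set xs \<subseteq> X" "\<not> hits (manipulated X f A) [] xs"
  shows "accepts (hom_query G H xs) A [] \<longleftrightarrow> (\<exists>h\<in>hom G H. \<forall>x\<in>set xs. f x = h x)"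
  using answers_eq_of_not_hits[OF assms]
  by (simp add: hom_query_def accepts_ask list_all2_map2 list_all2_same)

context exponent_p_group
begin

text \<open>
  The reserve \<open>us\<close> determines a random affine combination with coefficients \<open>1 # a\<close>; the leading
  \<open>1\<close> makes the combinations for distinct \<open>a\<close> pairwise independent.
\<close>

definition queries :: "'a list \<Rightarrow> 'a list \<Rightarrow> int list list \<Rightarrow> int list list \<Rightarrow> 'a list" where
  "queries us ys cs ds = us @ ys @ map (\<lambda>a. lincomb G us (1 # a)) cs @
     map2 (\<lambda>y a. y \<otimes> lincomb G us (1 # a)) ys ds"

lemma queries_closed:
  assumes "set us \<subseteq> carrier G" "set ys \<subseteq> carrier G"
  shows "set (queries us ys cs ds) \<subseteq> carrier G"
  using assms by (auto simp: queries_def dest!: set_zip_leftD)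

lemma length_queries:
  "length us = Suc k \<Longrightarrow> length ys = m \<Longrightarrow> length cs = m \<Longrightarrow> length ds = m \<Longrightarrow>
     length (queries us ys cs ds) = Suc k + 3 * m"
  by (simp add: queries_def)

text \<open>The components are in the order in which queries reveal them, so the nested averages of
  \<open>avg_coins\<close> keep the coins of later queries innermost.\<close>

definition coins where
  "coins k m = nlists (Suc k) (carrier G) \<times> nlists m (carrier G) \<times>
     nlists m (coeff_lists k) \<times> nlists m (coeff_lists k)"

lemma coins_fin: "finite (coins k m)" "coins k m \<noteq> {}"
  by (simp_all add: coins_def fin carrier_ne coeff_lists_fin finite_nlists nlists_nonempty)

lemma avg_coins: "avg (coins k m) F =
  avg (nlists (Suc k) (carrier G)) (\<lambda>us. avg (nlists m (carrier G)) (\<lambda>ys.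
    avg (nlists m (coeff_lists k)) (\<lambda>cs. avg (nlists m (coeff_lists k)) (\<lambda>ds. F (us, ys, cs, ds)))))"
  by (simp add: coins_def avg_Times)

lemma map2_replicate: "length xs = n \<Longrightarrow> map2 f (replicate n y) xs = map (f y) xs"
  by (induction xs arbitrary: n) auto

text \<open>Each of the four blocks of queries is bounded with the earlier blocks fixed: point
  probability \<open>1 / N\<close> for the first two, \<open>kernel_density k us\<close> for the
  last two. Since the latter depends on the reserve, the average over \<open>us\<close> is taken
  last.\<close>

lemma avg_hits_queries_le:
  assumes M: "\<And>qs. qs \<in> lists (carrier G) \<Longrightarrow> length qs \<le> q \<Longrightarrow> finite (M qs) \<and> real (card (M qs)) \<le> \<tau>"
    and \<tau>: "0 \<le> \<tau>" and q: "q = Suc k + 3 * m"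
  shows "avg (coins k m) (\<lambda>(us, ys, cs, ds). of_bool (hits M [] (queries us ys cs ds)))
    \<le> \<tau> * real q * (1 / N + 1 / real p ^ k)"
proof -
  let ?C = "carrier G" and ?K = "coeff_lists k"
  let ?U = "nlists (Suc k) ?C" and ?Y = "nlists m ?C" and ?B = "nlists m ?K"
  note ne = fin carrier_ne coeff_lists_fin[of k]
  have nl: "finite ?U" "?U \<noteq> {}" "finite ?Y" "?Y \<noteq> {}" "finite ?B" "?B \<noteq> {}"
    using ne by (auto intro!: finite_nlists nlists_nonempty)
  let ?L = "\<lambda>us a. lincomb G us (1 # a)"
  let ?F1 = "\<lambda>us. of_bool (hits M [] us) :: real"
  let ?F2 = "\<lambda>us ys. of_bool (hits M us ys) :: real"
  let ?F3 = "\<lambda>us ys cs. of_bool (hits M (us @ ys) (map (?L us) cs)) :: real"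
  let ?F4 = "\<lambda>us ys cs ds. of_bool (hits M (us @ ys @ map (?L us) cs) (map2 (\<lambda>y a. y \<otimes> ?L us a) ys ds)) :: real"
  have unif: "avg ?C (\<lambda>c. of_bool (c = z)) \<le> 1 / N" for z
  proof -
    have "card {c \<in> ?C. c = z} \<le> card {z}"
      by (intro card_mono) auto
    then show ?thesis
      using fin by (simp add: avg_of_bool_card divide_right_mono)
  qed
  have b1: "avg ?U ?F1 \<le> real (Suc k) * (\<tau> * (1 / N))"
  proof -
    \<comment> \<open>The entries \<open>()\<close> are dummy parameters: these queries are the
      coins themselves.\<close>
    have "avg ?U ?F1 = avg ?U (\<lambda>us. of_bool (hits M [] (map2 (\<lambda>_ c. c) (replicate (Suc k) ()) us)))"
      by (rule avg_cong) (simp_all add: map2_replicate del: replicate_Suc)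
    also have "\<dots> \<le> real (Suc k) * (\<tau> * (1 / N))"
      using ne M unif q by (intro avg_hits_le[where X = ?C and q = q]) auto
    finally show ?thesis .
  qed
  have b2: "avg ?Y (?F2 us) \<le> real m * (\<tau> * (1 / N))" if us: "us \<in> ?U" for us
  proof -
    have us': "us \<in> lists ?C" using nlistsE_set[OF us] by (auto simp: in_lists_conv_set)
    have "avg ?Y (?F2 us) = avg ?Y (\<lambda>ys. of_bool (hits M us (map2 (\<lambda>_ c. c) (replicate m ()) ys)))"
      by (rule avg_cong) (simp_all add: map2_replicate)
    also have "\<dots> \<le> real m * (\<tau> * (1 / N))"
      using ne M unif q us' nlistsE_length[OF us] by (intro avg_hits_le[where X = ?C and q = q]) auto
    finally show ?thesis .
  qed
  have b3: "avg ?B (?F3 us ys) \<le> real m * (\<tau> * kernel_density k us)" if us: "us \<in> ?U" and ys: "ys \<in> ?Y" for us ys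
  proof -
    have us': "set us \<subseteq> ?C" and ys': "set ys \<subseteq> ?C" using us ys by simp_all
    have "avg ?B (?F3 us ys) = avg ?B (\<lambda>cs. of_bool (hits M (us @ ys) (map2 (\<lambda>_. ?L us) (replicate m ()) cs)))"
      by (rule avg_cong) (simp_all add: map2_replicate)
    also have "\<dots> \<le> real m * (\<tau> * kernel_density k us)"
    proof (rule avg_hits_le[where X = ?C and q = q])
      \<comment> \<open>The fibre bound is used with \<open>y = \<one>\<close>.\<close>
      show "avg ?K (\<lambda>a. of_bool (?L us a = z)) \<le> kernel_density k us" for z
        using avg_affine_fibre_le[OF us one_closed, of z] us' by simp
      show "us @ ys \<in> lists ?C" using us' ys' by auto
      show "?L us a \<in> ?C" for a using us' by simp
    qed (use ne M q us ys kernel_density_nonneg in auto)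
    finally show ?thesis .
  qed
  have b4: "avg ?B (?F4 us ys cs) \<le> real m * (\<tau> * kernel_density k us)"
    if us: "us \<in> ?U" and ys: "ys \<in> ?Y" and cs: "cs \<in> ?B" for us ys cs
  proof (rule avg_hits_le[where X = ?C and q = q])
    have us': "set us \<subseteq> ?C" and ys': "set ys \<subseteq> ?C" using us ys by simp_all
    show "avg ?K (\<lambda>a. of_bool (y \<otimes> ?L us a = z)) \<le> kernel_density k us" if "y \<in> set ys" for y z
      using avg_affine_fibre_le[OF us, of y z] ys' that by auto
    show "y \<otimes> ?L us a \<in> ?C" if "y \<in> set ys" for y a
      using us' ys' that by auto
    show "us @ ys @ map (?L us) cs \<in> lists ?C"
      using us' ys' by auto
  qed (use ne M q us ys cs kernel_density_nonneg in auto)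
  have "avg (coins k m) (\<lambda>(us, ys, cs, ds). of_bool (hits M [] (queries us ys cs ds))) \<le>
    avg ?U (\<lambda>us. avg ?Y (\<lambda>ys. avg ?B (\<lambda>cs. avg ?B (\<lambda>ds.
      ?F1 us + (?F2 us ys + (?F3 us ys cs + ?F4 us ys cs ds))))))"
    unfolding avg_coins by (intro avg_mono) (auto simp: queries_def hits_append)
  also have "\<dots> = avg ?U (\<lambda>us. ?F1 us + avg ?Y (\<lambda>ys. ?F2 us ys + avg ?B (\<lambda>cs. ?F3 us ys cs + avg ?B (?F4 us ys cs))))"
    using nl by (simp add: avg_add avg_const)
  also have "\<dots> \<le> avg ?U (\<lambda>us. ?F1 us + (real m * (\<tau> * (1 / N)) +
      (real m * (\<tau> * kernel_density k us) + real m * (\<tau> * kernel_density k us))))"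
  proof (rule avg_mono)
    fix us assume us: "us \<in> ?U"
    have c: "avg ?B (\<lambda>cs. ?F3 us ys cs + avg ?B (?F4 us ys cs)) \<le>
        real m * (\<tau> * kernel_density k us) + real m * (\<tau> * kernel_density k us)" if "ys \<in> ?Y" for ys
      unfolding avg_add by (intro add_mono b3[OF us that] b4[OF us that] avg_le_const[OF nl(5,6)])
    show "?F1 us + avg ?Y (\<lambda>ys. ?F2 us ys + avg ?B (\<lambda>cs. ?F3 us ys cs + avg ?B (?F4 us ys cs))) \<le>
      ?F1 us + (real m * (\<tau> * (1 / N)) + (real m * (\<tau> * kernel_density k us) + real m * (\<tau> * kernel_density k us)))"
      unfolding avg_add[of ?Y] by (intro add_mono order_refl b2[OF us] c avg_le_const[OF nl(3,4)])
  qed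
  also have "\<dots> = avg ?U ?F1 + real m * (\<tau> * (1 / N)) + 2 * real m * \<tau> * avg ?U (kernel_density k)"
    using nl by (simp add: avg_add avg_const avg_cmult)
  also have "\<dots> \<le> real (Suc k) * (\<tau> * (1 / N)) + real m * (\<tau> * (1 / N)) + 2 * real m * \<tau> * (1 / real p ^ k + 1 / N)"
    using b1 avg_kernel_density_le \<tau> by (intro add_mono order_refl mult_left_mono) auto
  also have "\<dots> = \<tau> * (real q * (1 / N) + real (2 * m) * (1 / real p ^ k))"
    by (simp add: q algebra_simps add_divide_distrib)
  also have "\<dots> \<le> \<tau> * (real q * (1 / N) + real q * (1 / real p ^ k))"
    using \<tau> q by (intro mult_left_mono add_mono mult_right_mono) auto
  finally show ?thesis by (simp add: algebra_simps)
qed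

end

section \<open>The tester\<close>

context exponent_p_group
begin

text \<open>A homomorphism agreeing with \<open>f\<close> on the reserve must take the value
  \<open>?g a\<close> at \<open>?L a\<close>. A failed test at \<open>(?L a, y)\<close> therefore
  shows up at \<open>?L a\<close> or at \<open>y \<otimes> ?L a\<close>. The two failure rates add
  up to at least \<open>2 * \<eta>\<close>, so one is at least \<open>\<eta>\<close>, and the
  \<open>m\<close> independent late queries of that kind all miss it with probability at most
  \<open>(1 - \<eta>) ^ m\<close>.\<close>

lemma avg_survives_given_reserve_le:
  fixes H :: "('y, 'k) monoid_scheme"
  assumes H: "comm_group H" and f: "f \<in> carrier G \<rightarrow> carrier H"
    and us: "us \<in> nlists (Suc k) (carrier G)" and \<eta>: "0 \<le> \<eta>"
    and defect: "4 * \<eta> \<le> 2 * avg (coeff_lists k) (\<lambda>a. avg (carrier G) (\<lambda>y. of_bool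
      (f (lincomb G us (1 # a)) \<otimes>\<^bsub>H\<^esub> f y \<noteq> f (lincomb G us (1 # a) \<otimes> y))))"
  shows "avg (nlists m (carrier G)) (\<lambda>ys. avg (nlists m (coeff_lists k)) (\<lambda>cs.
     avg (nlists m (coeff_lists k)) (\<lambda>ds.
       of_bool (\<exists>h\<in>hom G H. \<forall>x\<in>set (queries us ys cs ds). f x = h x)))) \<le> (1 - \<eta>) ^ m"
proof -
  interpret H: comm_group H by (rule H)
  let ?C = "carrier G" and ?K = "coeff_lists k"
  let ?Y = "nlists m ?C" and ?B = "nlists m ?K"
  let ?L = "\<lambda>a. lincomb G us (1 # a)" and ?g = "\<lambda>a. lincomb H (map f us) (1 # a)"
  define E where "E ys cs ds \<longleftrightarrow> (\<exists>h\<in>hom G H. \<forall>x\<in>set (queries us ys cs ds). f x = h x)" for ys cs ds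
  have us': "set us \<subseteq> ?C" using us by simp
  have L: "?L a \<in> ?C" for a using us' by simp
  have fin': "finite ?K" "?K \<noteq> {}" "finite ?Y" "?Y \<noteq> {}" "finite ?B" "?B \<noteq> {}"
    by (simp_all add: fin carrier_ne coeff_lists_fin finite_nlists nlists_nonempty)
  have E: "(\<forall>a\<in>set cs. f (?L a) = ?g a) \<and> list_all2 (\<lambda>y a. f (y \<otimes> ?L a) = f y \<otimes>\<^bsub>H\<^esub> ?g a) ys ds"
    if "E ys cs ds" "ys \<in> ?Y" "ds \<in> ?B" for ys cs ds
  proof -
    have ys: "set ys \<subseteq> ?C" "length ys = m" "length ds = m" using that by simp_all
    from that(1) obtain h where h: "h \<in> hom G H"
      "\<And>x. x \<in> set us \<union> set ys \<union> ?L ` set cs \<union> (\<lambda>(y, a). y \<otimes> ?L a) ` set (zip ys ds) \<Longrightarrow> f x = h x"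
      by (auto simp: E_def queries_def)
    \<comment> \<open>This makes the forced value \<open>?g a\<close> independent of the choice of
      \<open>h\<close>.\<close>
    have map_eq: "map h us = map f us"
      using h(2) by simp
    have hL: "h (?L a) = ?g a" for a
      using lincomb_hom[OF h(1) is_group H.is_group us', of "1 # a"] unfolding map_eq .
    have "f (y \<otimes> ?L a) = f y \<otimes>\<^bsub>H\<^esub> ?g a" if "(y, a) \<in> set (zip ys ds)" for y a
    proof -
      have y: "y \<in> set ys" "y \<in> ?C"
        using set_zip_leftD[OF that] ys(1) by auto
      have "f (y \<otimes> ?L a) = h (y \<otimes> ?L a)"
        by (rule h(2)) (use that in force)
      also have "\<dots> = h y \<otimes>\<^bsub>H\<^esub> h (?L a)"
        using hom_mult[OF h(1)] y L by blast
      finally show ?thesis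
        using h(2)[of y] y hL by simp
    qed
    moreover have "f (?L a) = ?g a" if "a \<in> set cs" for a
      using h(2)[of "?L a"] that hL by simp
    ultimately show ?thesis
      using ys by (auto simp: list_all2_iff)
  qed
  define \<alpha> where "\<alpha> = avg ?K (\<lambda>a. of_bool (f (?L a) \<noteq> ?g a))"
  define \<beta> where "\<beta> = avg ?C (\<lambda>y. avg ?K (\<lambda>a. of_bool (f (y \<otimes> ?L a) \<noteq> f y \<otimes>\<^bsub>H\<^esub> ?g a)))"
  have "avg ?K (\<lambda>a. avg ?C (\<lambda>y. of_bool (f (?L a) \<otimes>\<^bsub>H\<^esub> f y \<noteq> f (?L a \<otimes> y)))) \<le>
    avg ?K (\<lambda>a. avg ?C (\<lambda>y. of_bool (f (?L a) \<noteq> ?g a) + of_bool (f (y \<otimes> ?L a) \<noteq> f y \<otimes>\<^bsub>H\<^esub> ?g a)))"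
  proof (intro avg_mono)
    fix a y assume "y \<in> ?C"
    then have "y \<otimes> ?L a = ?L a \<otimes> y" "f (?L a) \<otimes>\<^bsub>H\<^esub> f y = f y \<otimes>\<^bsub>H\<^esub> f (?L a)"
      using L f by (auto intro!: m_comm H.m_comm)
    then show "of_bool (f (?L a) \<otimes>\<^bsub>H\<^esub> f y \<noteq> f (?L a \<otimes> y)) \<le>
        (of_bool (f (?L a) \<noteq> ?g a) + of_bool (f (y \<otimes> ?L a) \<noteq> f y \<otimes>\<^bsub>H\<^esub> ?g a) :: real)"
      by auto
  qed
  also have "\<dots> = \<alpha> + \<beta>"
    by (simp add: avg_add avg_carrier_const \<alpha>_def \<beta>_def avg_swap[of ?K])
  finally have "\<eta> \<le> \<alpha> \<or> \<eta> \<le> \<beta>" using defect by linarith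
  then show ?thesis
  proof
    assume "\<eta> \<le> \<alpha>"
    have a1: "1 - \<alpha> = avg ?K (\<lambda>a. of_bool (f (?L a) = ?g a))"
      using avg_of_bool_not[OF fin'(1,2), of "\<lambda>a. f (?L a) = ?g a"] by (simp add: \<alpha>_def)
    have "avg ?Y (\<lambda>ys. avg ?B (\<lambda>cs. avg ?B (\<lambda>ds. of_bool (E ys cs ds)))) \<le>
      avg ?Y (\<lambda>ys. avg ?B (\<lambda>cs. avg ?B (\<lambda>ds. of_bool (\<forall>a\<in>set cs. f (?L a) = ?g a))))"
      using E by (intro avg_mono) auto
    also have "\<dots> = (1 - \<alpha>) ^ m"
      using fin' by (simp add: avg_const a1 avg_nlists_all)
    also have "\<dots> \<le> (1 - \<eta>) ^ m"
      using \<open>\<eta> \<le> \<alpha>\<close> a1 by (intro power_mono) (auto intro: avg_nonneg)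
    finally show ?thesis by (simp add: E_def)
  next
    assume "\<eta> \<le> \<beta>"
    let ?P = "\<lambda>y a. f (y \<otimes> ?L a) = f y \<otimes>\<^bsub>H\<^esub> ?g a"
    have "avg ?C (\<lambda>y. avg ?K (\<lambda>a. of_bool (\<not> ?P y a))) = avg ?C (\<lambda>y. 1 - avg ?K (\<lambda>a. of_bool (?P y a)))"
      using avg_of_bool_not[OF fin'(1,2)] by (intro avg_cong) auto
    then have b1: "1 - \<beta> = avg ?C (\<lambda>y. avg ?K (\<lambda>a. of_bool (?P y a)))"
      by (simp add: \<beta>_def avg_diff avg_carrier_const)
    have "avg ?Y (\<lambda>ys. avg ?B (\<lambda>cs. avg ?B (\<lambda>ds. of_bool (E ys cs ds)))) \<le>
      avg ?Y (\<lambda>ys. avg ?B (\<lambda>cs. avg ?B (\<lambda>ds. of_bool (list_all2 ?P ys ds))))"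
      using E by (intro avg_mono) auto
    also have "\<dots> = (1 - \<beta>) ^ m"
      using fin' by (simp add: avg_const b1 avg_nlists_list_all2)
    also have "\<dots> \<le> (1 - \<eta>) ^ m"
      using \<open>\<eta> \<le> \<beta>\<close> b1 by (intro power_mono) (auto intro!: avg_nonneg)
    finally show ?thesis by (simp add: E_def)
  qed
qed

text \<open>Reserves whose restricted defect falls below \<open>\<delta> / 2\<close> are charged to
  the first summand. For the others that defect is at least \<open>\<epsilon> / 12\<close>, twice
  the rate \<open>\<epsilon> / 24\<close> used for the late queries.\<close>

lemma avg_survives_le:
  fixes H :: "('y, 'k) monoid_scheme"
  assumes H: "comm_group H" and f: "f \<in> carrier G \<rightarrow> carrier H"
    and far: "eps_far_from_hom G H \<epsilon> f" and \<epsilon>: "0 < \<epsilon>" "\<epsilon> < 1"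
  shows "avg (coins k m) (\<lambda>(us, ys, cs, ds).
      of_bool (\<exists>h\<in>hom G H. \<forall>x\<in>set (queries us ys cs ds). f x = h x))
    \<le> 24 / (real p ^ k * \<epsilon>) + (1 - \<epsilon> / 24) ^ m"
proof -
  let ?C = "carrier G" and ?K = "coeff_lists k"
  let ?U = "nlists (Suc k) ?C" and ?Y = "nlists m ?C" and ?B = "nlists m ?K"
  have nl: "finite ?U" "?U \<noteq> {}" "finite ?Y" "?Y \<noteq> {}" "finite ?B" "?B \<noteq> {}"
    by (simp_all add: fin carrier_ne coeff_lists_fin finite_nlists nlists_nonempty)
  define \<delta> where "\<delta> = BLR_defect G H f"
  have \<delta>: "\<epsilon> / 6 \<le> \<delta>"
    unfolding \<delta>_def using BLR_defect_of_far[OF comm_group_axioms H fin f far \<epsilon>] .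
  define \<phi> where "\<phi> x = avg ?C (\<lambda>y. of_bool (f x \<otimes>\<^bsub>H\<^esub> f y \<noteq> f (x \<otimes> y)))" for x
  let ?S = "\<lambda>us. avg ?K (\<lambda>a. \<phi> (lincomb G us (1 # a)))"
  let ?E = "\<lambda>us ys cs ds. of_bool (\<exists>h\<in>hom G H. \<forall>x\<in>set (queries us ys cs ds). f x = h x) :: real"
  have "avg (coins k m) (\<lambda>(us, ys, cs, ds). ?E us ys cs ds) =
    avg ?U (\<lambda>us. avg ?Y (\<lambda>ys. avg ?B (\<lambda>cs. avg ?B (\<lambda>ds. ?E us ys cs ds))))"
    by (simp add: avg_coins)
  also have "\<dots> \<le> avg ?U (\<lambda>us. of_bool (?S us < \<delta> / 2) + (1 - \<epsilon> / 24) ^ m)"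
  proof (rule avg_mono)
    fix us assume us: "us \<in> ?U"
    show "avg ?Y (\<lambda>ys. avg ?B (\<lambda>cs. avg ?B (\<lambda>ds. ?E us ys cs ds))) \<le>
      of_bool (?S us < \<delta> / 2) + (1 - \<epsilon> / 24) ^ m"
    proof (cases "?S us < \<delta> / 2")
      case True
      have "avg ?Y (\<lambda>ys. avg ?B (\<lambda>cs. avg ?B (\<lambda>ds. ?E us ys cs ds))) \<le> 1"
        using nl by (intro avg_le_const) auto
      also have "\<dots> \<le> 1 + (1 - \<epsilon> / 24) ^ m" using \<epsilon> by simp
      finally show ?thesis using True by simp
    next
      case False
      then have "4 * (\<epsilon> / 24) \<le> 2 * ?S us" using \<delta> by simp
      from avg_survives_given_reserve_le[OF H f us _ this[unfolded \<phi>_def], of m]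
      show ?thesis using \<epsilon> False by simp
    qed
  qed
  also have "\<dots> = avg ?U (\<lambda>us. of_bool (?S us < \<delta> / 2)) + (1 - \<epsilon> / 24) ^ m"
    using nl by (simp add: avg_add avg_const)
  also have "avg ?U (\<lambda>us. of_bool (?S us < \<delta> / 2)) \<le> 4 / (real p ^ k * \<delta>)"
  proof (rule affine_concentration)
    show "0 \<le> \<phi> x \<and> \<phi> x \<le> 1" for x
      using fin carrier_ne by (auto simp: \<phi>_def intro: avg_nonneg avg_of_bool_le_1)
    show "avg ?C \<phi> = \<delta>" by (simp add: \<phi>_def[abs_def] \<delta>_def BLR_defect_def)
    show "0 < \<delta>" using \<delta> \<epsilon> by simp
  qed
  also have "4 / (real p ^ k * \<delta>) \<le> 4 / (real p ^ k * (\<epsilon> / 6))"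
    using \<delta> \<epsilon> p_pos by (intro divide_left_mono mult_left_mono) auto
  finally show ?thesis by simp
qed

definition affine_tester :: "('y, 'k) monoid_scheme \<Rightarrow> nat \<Rightarrow> nat \<Rightarrow> ('a, 'y) query_tree pmf" where
  "affine_tester H k m = map_pmf (\<lambda>(us, ys, cs, ds). hom_query G H (queries us ys cs ds))
     (pmf_of_set (coins k m))"

lemma prob_affine_tester:
  "measure_pmf.prob (affine_tester H k m) {d. Q d} =
     avg (coins k m) (\<lambda>(us, ys, cs, ds). of_bool (Q (hom_query G H (queries us ys cs ds))))"
  using prob_pmf_of_set_eq_avg[OF coins_fin[of k m], of "\<lambda>(us, ys, cs, ds). Q (hom_query G H (queries us ys cs ds))"]
  by (simp add: affine_tester_def vimage_def case_prod_unfold)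

lemma set_affine_tester:
  assumes "d \<in> set_pmf (affine_tester H k m)"
  obtains us ys cs ds where "d = hom_query G H (queries us ys cs ds)"
    "us \<in> nlists (Suc k) (carrier G)" "ys \<in> nlists m (carrier G)"
    "cs \<in> nlists m (coeff_lists k)" "ds \<in> nlists m (coeff_lists k)"
  using assms coins_fin[of k m] by (auto simp: affine_tester_def coins_def)

lemma affine_tester_query_bound:
  "real (Suc k + 3 * m) \<le> q \<Longrightarrow> makes_at_most_queries (affine_tester H k m) q"
  unfolding makes_at_most_queries_def
  by (auto elim!: set_affine_tester simp: hom_query_def query_count_ask length_queries[of _ k _ m])

text \<open>The input itself is a homomorphism consistent with all answers that are not erased,
  whatever the coins and the budget.\<close>

lemma affine_tester_one_sided: "one_sided G H (erasure_adversary G t) (affine_tester H k m)"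
  unfolding one_sided_def
proof (intro ballI allI impI)
  fix f \<A> assume f: "f \<in> hom G H" and \<A>: "erasure_adversary G t f \<A>"
  have "1 \<le> prob_accept (affine_tester H k m) \<A>"
    unfolding prob_accept_def
  proof (rule prob_pair_pmf_ge)
    fix A assume "A \<in> set_pmf \<A>"
    then have A: "budget_managing (carrier G) {None} t f A"
      using \<A> by (simp add: erasure_adversary_def)
    have "accepts d A []" if "d \<in> set_pmf (affine_tester H k m)" for d
      using that
    proof (rule set_affine_tester)
      fix us ys cs ds assume d: "d = hom_query G H (queries us ys cs ds)"
        "us \<in> nlists (Suc k) (carrier G)" "ys \<in> nlists m (carrier G)"
      then have "set (queries us ys cs ds) \<subseteq> carrier G"
        by (intro queries_closed) simp_all
      from erasure_answers[OF A this, of "[]"] show ?thesis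
        using f d by (auto simp: hom_query_def accepts_ask)
    qed
    then have "measure_pmf.prob (affine_tester H k m) {d. accepts d A []} = 1"
      by (subst measure_pmf.prob_eq_1) (auto simp: AE_measure_pmf_iff)
    then show "1 \<le> measure_pmf.prob (affine_tester H k m) {d. accepts d A []}" by simp
  qed
  moreover have "prob_accept (affine_tester H k m) \<A> \<le> 1"
    unfolding prob_accept_def by (rule measure_pmf.prob_le_1)
  ultimately show "prob_accept (affine_tester H k m) \<A> = 1" by simp
qed

text \<open>Unless a query hits a manipulated point, the verdict is the one for the unmanipulated
  \<open>f\<close>. The hitting probability bounds the error on homomorphisms; on far inputs the
  survival probability is added. Only the budget of the adversary enters, not the kind of
  manipulation.\<close>

lemma affine_tester_hom_tester:
  fixes H :: "('y, 'k) monoid_scheme"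
  assumes H: "comm_group H" and \<epsilon>: "0 < \<epsilon>" "\<epsilon> < 1" and t: "0 \<le> t"
    and adv: "\<And>f \<A> A. adv f \<A> \<Longrightarrow> A \<in> set_pmf \<A> \<Longrightarrow> \<exists>V. budget_managing (carrier G) V t f A"
    and q: "q = Suc k + 3 * m"
    and bound: "t * real q ^ 2 * (1 / N + 1 / real p ^ k) + 24 / (real p ^ k * \<epsilon>) + (1 - \<epsilon> / 24) ^ m \<le> 1/3"
  shows "hom_tester G H \<epsilon> adv (affine_tester H k m)"
  unfolding hom_tester_def
proof (intro conjI ballI allI impI)
  fix d assume "d \<in> set_pmf (affine_tester H k m)"
  then show "query_points d \<subseteq> carrier G"
  proof (rule set_affine_tester)
    fix us ys cs ds assume d: "d = hom_query G H (queries us ys cs ds)"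
      "us \<in> nlists (Suc k) (carrier G)" "ys \<in> nlists m (carrier G)"
    then show ?thesis
      unfolding d(1) hom_query_def query_points_ask by (intro queries_closed) simp_all
  qed
next
  fix f \<A> assume f: "f \<in> carrier G \<rightarrow> carrier H" and \<A>: "adv f \<A>"
  let ?T = "affine_tester H k m"
  define xs where "xs = (\<lambda>(us, ys, cs, ds). queries us ys cs ds)"
  define hit where "hit A = avg (coins k m) (\<lambda>\<omega>. of_bool (hits (manipulated (carrier G) f A) [] (xs \<omega>)))" for A
  have pos: "0 \<le> 24 / (real p ^ k * \<epsilon>)" "0 \<le> (1 - \<epsilon> / 24) ^ m" using \<epsilon> by auto
  have hit: "hit A \<le> t * real q ^ 2 * (1 / N + 1 / real p ^ k)" if A: "A \<in> set_pmf \<A>" for A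
  proof -
    obtain V where V: "budget_managing (carrier G) V t f A" using adv[OF \<A> A] by blast
    have "finite (manipulated (carrier G) f A qs) \<and> real (card (manipulated (carrier G) f A qs)) \<le> t * real q"
      if "qs \<in> lists (carrier G)" "length qs \<le> q" for qs
    proof
      show "finite (manipulated (carrier G) f A qs)" using fin by (simp add: manipulated_def)
      have "real (card (manipulated (carrier G) f A qs)) \<le> t * real (length qs)"
        using card_manipulated_le[OF V fin that(1)] .
      also have "\<dots> \<le> t * real q" using t that(2) by (intro mult_left_mono) auto
      finally show "real (card (manipulated (carrier G) f A qs)) \<le> t * real q" .
    qed
    from avg_hits_queries_le[OF this _ q] t show ?thesis
      by (simp add: hit_def xs_def case_prod_unfold power2_eq_square mult.assoc)
  qed
  have closed: "set (xs \<omega>) \<subseteq> carrier G" if "\<omega> \<in> coins k m" for \<omega>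
  proof -
    obtain us ys cs ds where \<omega>: "\<omega> = (us, ys, cs, ds)" by (cases \<omega>)
    have "us \<in> nlists (Suc k) (carrier G)" "ys \<in> nlists m (carrier G)"
      using that by (simp_all add: coins_def \<omega>)
    then have "set us \<subseteq> carrier G" "set ys \<subseteq> carrier G"
      by simp_all
    then show ?thesis unfolding \<omega> by (simp add: xs_def queries_closed)
  qed
  have acc: "accepts (hom_query G H (xs \<omega>)) A [] \<longleftrightarrow> (\<exists>h\<in>hom G H. \<forall>x\<in>set (xs \<omega>). f x = h x)"
    if "\<omega> \<in> coins k m" "\<not> hits (manipulated (carrier G) f A) [] (xs \<omega>)" for \<omega> A
    using accepts_hom_query_of_not_hits[OF closed[OF that(1)] that(2)] .
  have prob: "measure_pmf.prob ?T {d. Q d} = avg (coins k m) (\<lambda>\<omega>. of_bool (Q (hom_query G H (xs \<omega>))))" for Q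
    by (simp add: prob_affine_tester xs_def case_prod_unfold)
  {
    assume hom: "f \<in> hom G H"
    show "2 / 3 \<le> prob_accept ?T \<A>"
      unfolding prob_accept_def
    proof (rule prob_pair_pmf_ge)
      fix A assume A: "A \<in> set_pmf \<A>"
      have "avg (coins k m) (\<lambda>\<omega>. of_bool (\<not> accepts (hom_query G H (xs \<omega>)) A [])) \<le> hit A"
        unfolding hit_def
      proof (rule avg_mono)
        fix \<omega> assume "\<omega> \<in> coins k m"
        then have "hits (manipulated (carrier G) f A) [] (xs \<omega>) \<or> accepts (hom_query G H (xs \<omega>)) A []"
          using acc[of \<omega> A] hom by blast
        then show "of_bool (\<not> accepts (hom_query G H (xs \<omega>)) A []) \<le>
            (of_bool (hits (manipulated (carrier G) f A) [] (xs \<omega>)) :: real)"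
          by auto
      qed
      also have "\<dots> \<le> 1/3"
        using hit[OF A] bound pos by linarith
      finally show "2 / 3 \<le> measure_pmf.prob ?T {d. accepts d A []}"
        unfolding prob avg_of_bool_not[OF coins_fin] by simp
    qed
  }
  {
    assume far: "eps_far_from_hom G H \<epsilon> f"
    show "2 / 3 \<le> prob_reject ?T \<A>"
      unfolding prob_reject_def
    proof (rule prob_pair_pmf_ge)
      fix A assume A: "A \<in> set_pmf \<A>"
      have "avg (coins k m) (\<lambda>\<omega>. of_bool (accepts (hom_query G H (xs \<omega>)) A [])) \<le>
        avg (coins k m) (\<lambda>\<omega>. of_bool (hits (manipulated (carrier G) f A) [] (xs \<omega>)) +
          of_bool (\<exists>h\<in>hom G H. \<forall>x\<in>set (xs \<omega>). f x = h x))"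
        using acc by (intro avg_mono) auto
      also have "\<dots> \<le> hit A + (24 / (real p ^ k * \<epsilon>) + (1 - \<epsilon> / 24) ^ m)"
        unfolding avg_add hit_def[symmetric]
        using avg_survives_le[OF H f far \<epsilon>, of k m] by (simp add: xs_def case_prod_unfold)
      also have "\<dots> \<le> 1/3"
        using hit[OF A] bound by linarith
      finally show "2 / 3 \<le> measure_pmf.prob ?T {d. \<not> accepts d A []}"
        unfolding prob avg_of_bool_not[OF coins_fin] by simp
    qed
  }
qed

end

section \<open>The groups of vectors modulo p as elementary abelian groups\<close>

lemma comm_group_Fp_vec: "comm_group (Fp_vec p n)"
proof -
  interpret group "Fp_vec p n"
    by (simp add: Fp_vec_def)
  show ?thesis
    by unfold_locales (auto simp: Fp_vec_def add.commute intro!: restrict_ext)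
qed

lemma Fp_vec_finite_carrier: "0 < p \<Longrightarrow> finite (carrier (Fp_vec p n))"
  by (auto simp: Fp_vec_def carrier_integer_mod_group intro!: finite_PiE)

lemma Fp_vec_card: "0 < p \<Longrightarrow> card (carrier (Fp_vec p n)) = p ^ n"
  by (simp add: Fp_vec_def carrier_integer_mod_group card_PiE)

lemma Fp_vec_pow:
  assumes "x \<in> carrier (Fp_vec p n)"
  shows "x [^]\<^bsub>Fp_vec p n\<^esub> (m::nat) = (\<lambda>i\<in>{..<n}. (int m * x i) mod int p)"
proof (induction m)
  case 0
  then show ?case by (simp add: Fp_vec_def)
next
  case (Suc m)
  interpret comm_group "Fp_vec p n" by (rule comm_group_Fp_vec)
  have "x [^]\<^bsub>Fp_vec p n\<^esub> Suc m = (\<lambda>i\<in>{..<n}. (int m * x i) mod int p) \<otimes>\<^bsub>Fp_vec p n\<^esub> x"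
    by (simp only: nat_pow_Suc Suc.IH)
  also have "\<dots> = (\<lambda>i\<in>{..<n}. (int (Suc m) * x i) mod int p)"
    by (auto simp: Fp_vec_def restrict_def fun_eq_iff mod_simps algebra_simps)
  finally show ?case .
qed

lemma exponent_p_group_Fp_vec:
  assumes "prime p"
  shows "exponent_p_group (Fp_vec p n) p"
proof -
  interpret comm_group "Fp_vec p n" by (rule comm_group_Fp_vec)
  show ?thesis
    using assms prime_gt_0_nat[OF assms]
    by unfold_locales (auto simp: Fp_vec_finite_carrier Fp_vec_pow, simp add: Fp_vec_def)
qed

text \<open>The factor 2 covers \<open>s = 3\<close>, the only case where the square exceeds the
  power. It serves to absorb the square of the query number into \<open>p ^ k\<close>.\<close>

lemma square_le_power2: "(real s)\<^sup>2 \<le> 2 * 2 ^ s"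
proof -
  have "s * s \<le> 2 * 2 ^ s"
  proof (cases "s < 4")
    case True
    then have "s = 0 \<or> s = 1 \<or> s = 2 \<or> s = 3" by auto
    then show ?thesis by auto
  next
    case False
    then have "4 \<le> s" by simp
    then show ?thesis
    proof (induction s rule: dec_induct)
      case (step s)
      have "2 * s + 1 \<le> s * s" using step(1) mult_le_mono1[of 4 s s] by linarith
      then show ?case using step by simp
    qed simp
  qed
  then have "real (s * s) \<le> real (2 * 2 ^ s)" by (rule of_nat_mono)
  then show ?thesis by (simp add: power2_eq_square)
qed

section \<open>Parameters\<close>

text \<open>Bernoulli bounds \<open>(1 + x) ^ m\<close> from below, and
  \<open>(1 - x) * (1 + x)\<close> is at most 1.\<close>

lemma power_le_inverse_Suc:
  assumes "0 \<le> x" "x \<le> 1"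
  shows "(1 - x) ^ m \<le> 1 / (1 + real m * x)"
proof -
  have "(1 - x) ^ m * (1 + real m * x) \<le> (1 - x) ^ m * (1 + x) ^ m"
    using assms Bernoulli_inequality[of x m] by (intro mult_left_mono) auto
  also have "\<dots> = (1 - x\<^sup>2) ^ m"
    by (simp add: power_mult_distrib[symmetric] power2_eq_square algebra_simps)
  also have "\<dots> \<le> 1"
    using assms by (intro power_le_one) (auto simp: power_le_one)
  finally show ?thesis
    using assms by (simp add: field_simps add_pos_nonneg)
qed

text \<open>The four error terms are bounded by \<open>1/12\<close>, \<open>1/24\<close>,
  \<open>1/24\<close> and \<open>1/12\<close>. In \<open>k\<close>, one copy of \<open>e\<close>
  pays for \<open>t\<close>; the other, with \<open>40 * s\<close>, pays for the square of
  \<open>q\<close> and for \<open>1 / \<epsilon>\<close>.\<close>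

lemma parameters:
  fixes p n :: nat and \<epsilon> t :: real
  defines "s \<equiv> nat \<lceil>1 / \<epsilon>\<rceil>" and "e \<equiv> nat \<lceil>log (real p) (max 1 t)\<rceil>"
  assumes p: "2 \<le> p" and n: "1 \<le> n" and \<epsilon>: "0 < \<epsilon>" "\<epsilon> < 1" and t: "0 \<le> t"
    "t \<le> 1 / 10 ^ 8 * min (\<epsilon>\<^sup>2) (1 / (real n)\<^sup>2) * real p ^ n"
    and k: "k = 2 * e + 40 * s" and m: "m = 264 * s" and q: "q = Suc k + 3 * m"
  shows "t * real q ^ 2 * (1 / real p ^ n + 1 / real p ^ k) + 24 / (real p ^ k * \<epsilon>) + (1 - \<epsilon> / 24) ^ m \<le> 1/3"
    and "real q \<le> 2500 * (1 / \<epsilon> + log (real p) (max 1 t))"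
proof -
  define l where "l = log (real p) (max 1 t)"
  have p': "1 < real p" using p by simp
  have l0: "0 \<le> l" using p' by (simp add: l_def)
  have e: "l \<le> real e" "real e \<le> l + 1"
    using l0 unfolding e_def l_def[symmetric] by linarith+
  have inv: "1 < 1 / \<epsilon>" using \<epsilon> by simp
  have s: "1 / \<epsilon> \<le> real s" "real s \<le> 1 / \<epsilon> + 1" "1 \<le> s"
    using inv unfolding s_def by linarith+
  \<comment> \<open>Here \<open>q = 2 * e + 832 * s + 1\<close>, and \<open>1 \<le> s\<close>
    absorbs the final 1.\<close>
  have q_le: "real q \<le> 833 * (real e + real s)"
    using s(3) by (simp add: q k m)
  show "real q \<le> 2500 * (1 / \<epsilon> + log (real p) (max 1 t))"
  proof -
    define y where "y = 1 / \<epsilon>"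
    note q_le
    also have "833 * (real e + real s) \<le> 833 * ((l + 1) + (y + 1))"
      unfolding y_def using e s by (intro mult_left_mono add_mono) auto
    \<comment> \<open>As \<open>y > 1\<close>, the additive 1666 is at most \<open>1666 * y\<close>,
      and 833 + 1666 = 2499.\<close>
    also have "\<dots> \<le> 2500 * (y + l)"
      using inv l0 unfolding y_def[symmetric] by (simp add: algebra_simps)
    finally show ?thesis by (simp add: y_def l_def)
  qed

  define \<mu> where "\<mu> = min (\<epsilon>\<^sup>2) (1 / (real n)\<^sup>2)"
  have \<mu>: "0 \<le> \<mu>" "\<mu> \<le> 1" "\<mu> * (real n)\<^sup>2 \<le> 1" "\<mu> * (1 / \<epsilon>)\<^sup>2 \<le> 1"
  proof -
    show "0 \<le> \<mu>" by (simp add: \<mu>_def)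
    show "\<mu> \<le> 1" using \<epsilon> by (simp add: \<mu>_def min_le_iff_disj power_le_one)
    have "\<mu> * (real n)\<^sup>2 \<le> 1 / (real n)\<^sup>2 * (real n)\<^sup>2" by (intro mult_right_mono) (auto simp: \<mu>_def)
    then show "\<mu> * (real n)\<^sup>2 \<le> 1" using n by simp
    have "\<mu> * (1 / \<epsilon>)\<^sup>2 \<le> \<epsilon>\<^sup>2 * (1 / \<epsilon>)\<^sup>2" by (intro mult_right_mono) (auto simp: \<mu>_def)
    then show "\<mu> * (1 / \<epsilon>)\<^sup>2 \<le> 1" using \<epsilon> by (simp add: power_divide)
  qed
  have pn: "1 \<le> real p ^ n" using p' by simp
  have t\<mu>: "t \<le> 1 / 10 ^ 8 * \<mu> * real p ^ n" using t by (simp add: \<mu>_def)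
  have "1 / 10 ^ 8 * \<mu> * real p ^ n \<le> 1 * real p ^ n" using \<mu> pn by (intro mult_right_mono) auto
  then have "max 1 t \<le> real p ^ n" using t\<mu> pn by auto
  then have "l \<le> log (real p) (real p ^ n)"
    unfolding l_def using p' by (intro log_mono) auto
  then have "l \<le> real n" using p' by (simp add: log_nat_power)
  \<comment> \<open>The ceiling stays below the integer \<open>n\<close>; this ties \<open>e\<close>
    to the factor \<open>1 / n\<^sup>2\<close> in the bound on \<open>t\<close>.\<close>
  then have en: "e \<le> n" unfolding e_def l_def[symmetric] by linarith
  have pe: "max 1 t \<le> real p ^ e"
  proof -
    have "max 1 t = real p powr l" using p' by (simp add: l_def)
    also have "\<dots> \<le> real p powr real e" using p' e by (intro powr_mono) auto
    finally show ?thesis using p' by (simp add: powr_realpow)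
  qed
  have P: "max 1 t * (2 ^ (e + s) * 2 ^ 39) \<le> real p ^ k"
  proof -
    \<comment> \<open>The exponent \<open>40 * s\<close> splits into \<open>s\<close> and
      \<open>39 * s\<close>, and \<open>1 \<le> s\<close> leaves a constant factor
      \<open>2 ^ 39\<close> to spare.\<close>
    have "(2::real) ^ (e + s) * 2 ^ 39 \<le> 2 ^ (e + s) * 2 ^ (39 * s)"
      using s(3) by (intro mult_left_mono power_increasing) auto
    also have "\<dots> = 2 ^ (e + 40 * s)"
      unfolding power_add[symmetric] by (rule arg_cong[of _ _ "power 2"]) simp
    also have "\<dots> \<le> real p ^ (e + 40 * s)"
      using p by (intro power_mono) auto
    finally have "max 1 t * (2 ^ (e + s) * 2 ^ 39) \<le> real p ^ e * real p ^ (e + 40 * s)"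
      using pe by (intro mult_mono) auto
    also have "\<dots> = real p ^ k"
      unfolding power_add[symmetric] k by (rule arg_cong[of _ _ "power (real p)"]) simp
    finally show ?thesis .
  qed
  have Ppos: "0 < real p ^ k" using p' by simp
  have q2: "real q ^ 2 \<le> 833\<^sup>2 * (real e + real s)\<^sup>2"
    unfolding power_mult_distrib[symmetric] using q_le by (intro power_mono) auto

  have i: "t * real q ^ 2 / real p ^ k \<le> 1 / 24"
  proof -
    have "real q ^ 2 \<le> 833\<^sup>2 * (2 * 2 ^ (e + s))"
      using q2 square_le_power2[of "e + s"] by simp
    then have "t * real q ^ 2 \<le> max 1 t * (833\<^sup>2 * (2 * 2 ^ (e + s)))"
      using t by (intro mult_mono) auto
    also have "\<dots> \<le> 1 / 24 * (max 1 t * (2 ^ (e + s) * 2 ^ 39))" by simp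
    also have "\<dots> \<le> 1 / 24 * real p ^ k" using P by simp
    finally show ?thesis using Ppos by (simp add: field_simps)
  qed
  have ii: "t * real q ^ 2 / real p ^ n \<le> 1 / 12"
  proof -
    \<comment> \<open>Since \<open>1 / \<epsilon> > 1\<close>, rounding up at most doubles it, so
      \<open>s \<le> 2 / \<epsilon>\<close>.\<close>
    have "(real e + real s)\<^sup>2 \<le> (real n + 2 * (1 / \<epsilon>))\<^sup>2"
      using en s inv by (intro power_mono add_mono) auto
    also have "\<dots> \<le> 2 * (real n)\<^sup>2 + 8 * (1 / \<epsilon>)\<^sup>2"
      using sum_squares_bound[of "real n" "2 * (1 / \<epsilon>)"] by (simp add: power2_sum power_divide)
    finally have "\<mu> * (real e + real s)\<^sup>2 \<le> \<mu> * (2 * (real n)\<^sup>2 + 8 * (1 / \<epsilon>)\<^sup>2)"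
      using \<mu> by (intro mult_left_mono) auto
    also have "\<dots> = 2 * (\<mu> * (real n)\<^sup>2) + 8 * (\<mu> * (1 / \<epsilon>)\<^sup>2)"
      by (simp add: algebra_simps)
    also have "\<dots> \<le> 10" using \<mu> by linarith
    finally have 10: "\<mu> * (real e + real s)\<^sup>2 \<le> 10" .
    have "t * real q ^ 2 \<le> (1 / 10 ^ 8 * \<mu> * real p ^ n) * (833\<^sup>2 * (real e + real s)\<^sup>2)"
      using t\<mu> q2 \<mu> pn by (intro mult_mono) auto
    also have "\<dots> = real p ^ n * (833\<^sup>2 / 10 ^ 8) * (\<mu> * (real e + real s)\<^sup>2)"
      by simp
    also have "\<dots> \<le> real p ^ n * (833\<^sup>2 / 10 ^ 8) * 10"
      using 10 by (intro mult_left_mono) auto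
    \<comment> \<open>The constant \<open>10 ^ 8\<close> is chosen for this: ten times 833 squared
      is below \<open>10 ^ 8 / 12\<close>.\<close>
    also have "\<dots> \<le> real p ^ n * (1 / 12)" using pn by simp
    finally show ?thesis using p' by (simp add: pos_divide_le_eq)
  qed
  have iii: "24 / (real p ^ k * \<epsilon>) \<le> 1 / 24"
  proof -
    have "24 * (1 / \<epsilon>) \<le> 24 * 2 ^ s"
      using s(1) of_nat_less_two_power[of s, where 'a = real] by linarith
    also have "\<dots> \<le> 1 / 24 * (1 * (2 ^ s * 2 ^ 39))" by simp
    also have "\<dots> \<le> 1 / 24 * (max 1 t * (2 ^ (e + s) * 2 ^ 39))"
      by (intro mult_left_mono mult_mono power_increasing) auto
    also have "\<dots> \<le> 1 / 24 * real p ^ k" using P by simp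
    finally show ?thesis using Ppos \<epsilon> by (simp add: field_simps)
  qed
  have iv: "(1 - \<epsilon> / 24) ^ m \<le> 1 / 12"
  proof -
    have "1 \<le> real s * \<epsilon>" using s(1) \<epsilon> by (simp add: field_simps)
    \<comment> \<open>264 is 11 times 24, so the product is at least 11.\<close>
    then have "12 \<le> 1 + real m * (\<epsilon> / 24)" by (simp add: m mult.commute)
    then have "1 / (1 + real m * (\<epsilon> / 24)) \<le> 1 / 12"
      using le_imp_inverse_le[of 12 "1 + real m * (\<epsilon> / 24)"] by (simp only: inverse_eq_divide)
    then show ?thesis
      using power_le_inverse_Suc[of "\<epsilon> / 24" m] \<epsilon> by linarith
  qed
  have "t * real q ^ 2 * (1 / real p ^ n + 1 / real p ^ k) =
    t * real q ^ 2 / real p ^ n + t * real q ^ 2 / real p ^ k"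
    by (simp add: algebra_simps)
  then show "t * real q ^ 2 * (1 / real p ^ n + 1 / real p ^ k) + 24 / (real p ^ k * \<epsilon>) + (1 - \<epsilon> / 24) ^ m \<le> 1/3"
    using i ii iii iv by linarith
qed

theorem theorem1p5:
  shows "\<exists>c::real. c > 0 \<and> (\<exists>C::real. C > 0 \<and>
    (\<forall>(p::nat) (n::nat) (r::nat) (\<epsilon>::real) (t::real).
       prime p \<and> n \<ge> 1 \<and> 0 < \<epsilon> \<and> \<epsilon> < 1 \<and>
       0 \<le> t \<and> t \<le> c * min (\<epsilon>^2) (1 / (real n)^2) * real p ^ n \<longrightarrow>
       (\<exists>T :: (nat \<Rightarrow> int, nat \<Rightarrow> int) query_tree pmf.
          makes_at_most_queries T (C * (1 / \<epsilon> + log (real p) (max 1 t))) \<and>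
          hom_tester (Fp_vec p n) (Fp_vec p r) \<epsilon>
            (erasure_adversary (Fp_vec p n) t) T \<and>
          hom_tester (Fp_vec p n) (Fp_vec p r) \<epsilon>
            (corruption_adversary (Fp_vec p n) (Fp_vec p r) t) T \<and>
          one_sided (Fp_vec p n) (Fp_vec p r)
            (erasure_adversary (Fp_vec p n) t) T)))"
proof -
  have "\<exists>T :: (nat \<Rightarrow> int, nat \<Rightarrow> int) query_tree pmf.
          makes_at_most_queries T (2500 * (1 / \<epsilon> + log (real p) (max 1 t))) \<and>
          hom_tester (Fp_vec p n) (Fp_vec p r) \<epsilon>
            (erasure_adversary (Fp_vec p n) t) T \<and>
          hom_tester (Fp_vec p n) (Fp_vec p r) \<epsilon>
            (corruption_adversary (Fp_vec p n) (Fp_vec p r) t) T \<and>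
          one_sided (Fp_vec p n) (Fp_vec p r)
            (erasure_adversary (Fp_vec p n) t) T"
    if "prime p" and n: "n \<ge> 1" and \<epsilon>: "0 < \<epsilon>" "\<epsilon> < 1"
      and t: "0 \<le> t" "t \<le> 1 / 10 ^ 8 * min (\<epsilon>^2) (1 / (real n)^2) * real p ^ n"
    for p n r :: nat and \<epsilon> t :: real
  proof -
    have E: "exponent_p_group (Fp_vec p n) p"
      using \<open>prime p\<close> by (rule exponent_p_group_Fp_vec)
    define s where "s = nat \<lceil>1 / \<epsilon>\<rceil>"
    define k where "k = 2 * nat \<lceil>log (real p) (max 1 t)\<rceil> + 40 * s"
    define q where "q = Suc k + 3 * (264 * s)"
    define T :: "(nat \<Rightarrow> int, nat \<Rightarrow> int) query_tree pmf"
      where "T = exponent_p_group.affine_tester (Fp_vec p n) p (Fp_vec p r) k (264 * s)"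
    have p: "2 \<le> p" using \<open>prime p\<close> by (rule prime_ge_2_nat)
    have N: "real (card (carrier (Fp_vec p n))) = real p ^ n" using p by (simp add: Fp_vec_card)
    note params = parameters[OF p n \<epsilon> t, of k "264 * s" q, folded s_def, OF k_def refl q_def]
    \<comment> \<open>One and the same \<open>T\<close> is shown to work for both adversary
      classes.\<close>
    have tester: "hom_tester (Fp_vec p n) (Fp_vec p r) \<epsilon> adv T"
      if "\<And>f \<A> A. adv f \<A> \<Longrightarrow> A \<in> set_pmf \<A> \<Longrightarrow> \<exists>V. budget_managing (carrier (Fp_vec p n)) V t f A" for adv
      unfolding T_def
      by (rule exponent_p_group.affine_tester_hom_tester[OF E comm_group_Fp_vec \<epsilon> t(1) that q_def])
        (use params(1) N in auto)
    have "makes_at_most_queries T (2500 * (1 / \<epsilon> + log (real p) (max 1 t)))"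
      unfolding T_def using params(2)
      by (intro exponent_p_group.affine_tester_query_bound[OF E]) (simp add: q_def)
    moreover have "one_sided (Fp_vec p n) (Fp_vec p r) (erasure_adversary (Fp_vec p n) t) T"
      unfolding T_def by (rule exponent_p_group.affine_tester_one_sided[OF E])
    moreover have "hom_tester (Fp_vec p n) (Fp_vec p r) \<epsilon> (erasure_adversary (Fp_vec p n) t) T"
      by (rule tester) (auto simp: erasure_adversary_def)
    moreover have "hom_tester (Fp_vec p n) (Fp_vec p r) \<epsilon>
        (corruption_adversary (Fp_vec p n) (Fp_vec p r) t) T"
      by (rule tester) (auto simp: corruption_adversary_def)
    ultimately show ?thesis by blast
  qed
  then show ?thesis
    by (intro exI[of _ "1 / 10 ^ 8"] conjI exI[of _ 2500]) auto
qed

end
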